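(* Consider the non-stationary generalized forward-backward iteration $\boldsymbol z_{k+1}=\boldsymbol z_k+\lambda_k(\boldsymbol T_\gamma\boldsymbol z_k+\boldsymbol\pi_k-\boldsymbol z_k)$ on $\boldsymbol{\mathcal H}=\mathcal H^n$ described in the context, with $\boldsymbol z_0\in\boldsymbol{\mathcal H}$. Assume: (A''.1) $\mathrm{zer}(B+\sum_iA_i)\neq\emptyset$; (A''.2) $\lambda_k\in(0,\frac1{\alpha_k})$ and $\inf_{k\in\mathbb N}\lambda_k(\frac1{\alpha_k}-\lambda_k)>0$; (A''.3) $\sum_k\lambda_k\|b_k\|<+\infty$ and $\sum_k\lambda_k\|a_{i,k}\|<+\infty$ for all $i\in\{1,\dots,n\}$; (A''.4) $0<\underline\gamma\le\gamma_k\le\overline\gamma<2\beta$ for all $k$, $\gamma\in[\underline\gamma,\overline\gamma]$, and $\sum_k\lambda_k|\gamma_k-\gamma|<+\infty$. Then $(\boldsymbol z_k)_{k\in\mathbb N}$ converges weakly to a point in $\mathrm{fix}\,\boldsymbol T_\gamma$. If, further, $\sum_k(k+1)|\gamma_k-\gamma|<+\infty$, $\sum_k(k+1)\|b_k\|<+\infty$ and $\sum_k(k+1)\|a_{i,k}\|<+\infty$ for all $i\in\{1,\dots,n\}$, then there is a finite constant $C_1$ such that for all $k\in\mathbb N$ $$\|\boldsymbol e_k\|\le\sqrt{\frac{d_0^2+C_1}{\underline\tau(k+1)}},$$ where $\boldsymbol e_k=(\mathrm{Id}-\boldsymbol T_\gamma)\boldsymbol z_k$, $d_0=\inf_{\boldsymbol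 z\in\mathrm{fix}\,\boldsymbol T_\gamma}\|\boldsymbol z_0-\boldsymbol z\|$ and $\underline\tau=\inf_{k}\lambda_k(\frac1{\alpha_k}-\lambda_k)$.
   Context: $\mathcal H$ is a real Hilbert space, $B:\mathcal H\to\mathcal H$ is $\beta$-cocoercive ($\beta>0$: $\beta\|Bx-By\|^2\le\langle Bx-By,x-y\rangle$), $A_i:\mathcal H\to2^{\mathcal H}$, $i=1,\dots,n$, are maximal monotone, $\omega_i\in(0,1)$ with $\sum_i\omega_i=1$; $b_k,a_{i,k}\in\mathcal H$ are errors; $\mathrm{zer}\,A=\{x:0\in Ax\}$; $J_A=(\mathrm{Id}+A)^{-1}$. $\boldsymbol{\mathcal H}=\mathcal H^n$ carries $\langle\boldsymbol x,\boldsymbol y\rangle=\sum_i\omega_i\langle x_i,y_i\rangle$ and the associated norm. $\boldsymbol{\mathcal S}=\{\boldsymbol x:x_1=\dots=x_n\}$, $P_{\boldsymbol{\mathcal S}}\boldsymbol z=(\sum_i\omega_iz_i,\dots,\sum_i\omega_iz_i)$, $R_{\boldsymbol{\mathcal S}}=2P_{\boldsymbol{\mathcal S}}-\mathrm{Id}$, $\boldsymbol B_{\boldsymbol{\mathcal S}}\boldsymbol z=(B(\sum_j\omega_jz_j))_i$. For $s\in(0,2\beta)$: $J_{s\boldsymbol A}\boldsymbol z=(J_{\frac s{\omega_i}A_i}z_i)_i$, $R_{s\boldsymbol A}=2J_{s\boldsymbol A}-\mathrm{Id}$, $\boldsymbol T_{1,s}=\frac12(R_{s\boldsymbol A}R_{\boldsymbol{\mathcal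 S}}+\mathrm{Id})$, $\boldsymbol T_{2,s}=\mathrm{Id}-s\boldsymbol B_{\boldsymbol{\mathcal S}}$, $\boldsymbol T_s=\boldsymbol T_{1,s}\boldsymbol T_{2,s}$. For $\gamma,\gamma_k\in(0,2\beta)$ put $\alpha_k=\frac{2\beta}{4\beta-\gamma_k}$. Errors: $\boldsymbol\varepsilon_{1,k}=(b_k,\dots,b_k)$, $\boldsymbol\varepsilon_{2,k}=(a_{i,k})_i$, $\boldsymbol\varepsilon_k=\big(\boldsymbol T_{1,\gamma_k}(\boldsymbol T_{2,\gamma_k}\boldsymbol z_k+\boldsymbol\varepsilon_{1,k})+\boldsymbol\varepsilon_{2,k}\big)-\boldsymbol T_{\gamma_k}\boldsymbol z_k$, and $\boldsymbol\pi_k=(\boldsymbol T_{\gamma_k}-\boldsymbol T_\gamma)\boldsymbol z_k+\boldsymbol\varepsilon_k$. Thus the iteration is $\boldsymbol z_{k+1}=\boldsymbol z_k+\lambda_k(\boldsymbol T_{\gamma_k}\boldsymbol z_k+\boldsymbol\varepsilon_k-\boldsymbol z_k)$. *)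

theory Defs
  imports "HOL-Analysis.Analysis" "HOL-Library.Set_Algebras"
begin

text \<open>A set-valued operator is a function \<open>'a \<Rightarrow> 'a set\<close>. Sums of values are Minkowski sums,
  i.e. the operations \<open>+\<close> and \<open>\<Sum>\<close> of \<^theory>\<open>HOL-Library.Set_Algebras\<close>.\<close>

definition cocoercive :: "real \<Rightarrow> ('a::real_inner \<Rightarrow> 'a) \<Rightarrow> bool" where
  "cocoercive \<beta> B \<longleftrightarrow> \<beta> > 0 \<and> (\<forall>x y. \<beta> * (norm (B x - B y))\<^sup>2 \<le> inner (B x - B y) (x - y))"

definition monotone_op :: "('a::real_inner \<Rightarrow> 'a set) \<Rightarrow> bool" where
  "monotone_op A \<longleftrightarrow> (\<forall>x y. \<forall>u\<in>A x. \<forall>v\<in>A y. 0 \<le> inner (u - v) (x - y))"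

definition maximal_monotone :: "('a::real_inner \<Rightarrow> 'a set) \<Rightarrow> bool" where
  "maximal_monotone A \<longleftrightarrow>
     monotone_op A \<and> (\<forall>A'. monotone_op A' \<and> (\<forall>x. A x \<subseteq> A' x) \<longrightarrow> A' = A)"

definition zer :: "('a::zero \<Rightarrow> 'a set) \<Rightarrow> 'a set" where
  "zer A = {x. 0 \<in> A x}"

definition op_inverse :: "('a \<Rightarrow> 'a set) \<Rightarrow> 'a \<Rightarrow> 'a set" where
  "op_inverse A u = {x. u \<in> A x}"

definition op_scale :: "real \<Rightarrow> ('a::real_vector \<Rightarrow> 'a set) \<Rightarrow> 'a \<Rightarrow> 'a set" where
  "op_scale c A x = (\<lambda>u. c *\<^sub>R u) ` A x"

text \<open>\<open>(Id + A)\<^sup>-\<^sup>1\<close> read as a single-valued map. For a maximal monotone operator on a Hilbert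
  space the inverse has exactly one value at every point (Minty), so the description is proper;
  for other operators the value is unspecified where existence or uniqueness fails.\<close>

definition resolvent :: "('a::real_vector \<Rightarrow> 'a set) \<Rightarrow> 'a \<Rightarrow> 'a" where
  "resolvent A x = (THE p. p \<in> op_inverse (\<lambda>y. {y} + A y) x)"

definition fix_set :: "('a \<Rightarrow> 'a) \<Rightarrow> 'a set" where
  "fix_set T = {x. T x = x}"

text \<open>The product space is carried by \<open>'a ^ 'n\<close>, of which only the vector space operations are
  used. Its library inner product and norm are the unweighted ones, so the weighted versions
  below take their place throughout.\<close>

definition winner :: "('n::finite \<Rightarrow> real) \<Rightarrow> ('a::real_inner) ^ 'n \<Rightarrow> 'a ^ 'n \<Rightarrow> real" where
  "winner \<omega> x y = (\<Sum>i\<in>UNIV. \<omega> i * inner (x $ i) (y $ i))"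

definition wnorm :: "('n::finite \<Rightarrow> real) \<Rightarrow> ('a::real_inner) ^ 'n \<Rightarrow> real" where
  "wnorm \<omega> x = sqrt (winner \<omega> x x)"

definition weakly_converges ::
    "('n::finite \<Rightarrow> real) \<Rightarrow> (nat \<Rightarrow> ('a::real_inner) ^ 'n) \<Rightarrow> 'a ^ 'n \<Rightarrow> bool" where
  "weakly_converges \<omega> z l \<longleftrightarrow> (\<forall>u. (\<lambda>k. winner \<omega> (z k) u) \<longlonglongrightarrow> winner \<omega> l u)"

definition wavg :: "('n::finite \<Rightarrow> real) \<Rightarrow> ('a::real_vector) ^ 'n \<Rightarrow> 'a" where
  "wavg \<omega> z = (\<Sum>i\<in>UNIV. \<omega> i *\<^sub>R z $ i)"

definition P_S :: "('n::finite \<Rightarrow> real) \<Rightarrow> ('a::real_vector) ^ 'n \<Rightarrow> 'a ^ 'n" where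
  "P_S \<omega> z = (\<chi> i. wavg \<omega> z)"

definition R_S :: "('n::finite \<Rightarrow> real) \<Rightarrow> ('a::real_vector) ^ 'n \<Rightarrow> 'a ^ 'n" where
  "R_S \<omega> z = 2 *\<^sub>R P_S \<omega> z - z"

definition B_S :: "('n::finite \<Rightarrow> real) \<Rightarrow> ('a::real_vector \<Rightarrow> 'a) \<Rightarrow> 'a ^ 'n \<Rightarrow> 'a ^ 'n" where
  "B_S \<omega> B z = (\<chi> i. B (wavg \<omega> z))"

definition J_A ::
    "('n::finite \<Rightarrow> real) \<Rightarrow> ('n \<Rightarrow> 'a::real_vector \<Rightarrow> 'a set) \<Rightarrow> real \<Rightarrow> 'a ^ 'n \<Rightarrow> 'a ^ 'n" where
  "J_A \<omega> A s z = (\<chi> i. resolvent (op_scale (s / \<omega> i) (A i)) (z $ i))"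

definition R_A ::
    "('n::finite \<Rightarrow> real) \<Rightarrow> ('n \<Rightarrow> 'a::real_vector \<Rightarrow> 'a set) \<Rightarrow> real \<Rightarrow> 'a ^ 'n \<Rightarrow> 'a ^ 'n" where
  "R_A \<omega> A s z = 2 *\<^sub>R J_A \<omega> A s z - z"

definition T1 ::
    "('n::finite \<Rightarrow> real) \<Rightarrow> ('n \<Rightarrow> 'a::real_vector \<Rightarrow> 'a set) \<Rightarrow> real \<Rightarrow> 'a ^ 'n \<Rightarrow> 'a ^ 'n" where
  "T1 \<omega> A s z = (1/2) *\<^sub>R (R_A \<omega> A s (R_S \<omega> z) + z)"

definition T2 ::
    "('n::finite \<Rightarrow> real) \<Rightarrow> ('a::real_vector \<Rightarrow> 'a) \<Rightarrow> real \<Rightarrow> 'a ^ 'n \<Rightarrow> 'a ^ 'n" where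
  "T2 \<omega> B s z = z - s *\<^sub>R B_S \<omega> B z"

definition T_gfb ::
    "('n::finite \<Rightarrow> real) \<Rightarrow> ('n \<Rightarrow> 'a::real_vector \<Rightarrow> 'a set) \<Rightarrow> ('a \<Rightarrow> 'a) \<Rightarrow> real
      \<Rightarrow> 'a ^ 'n \<Rightarrow> 'a ^ 'n" where
  "T_gfb \<omega> A B s z = T1 \<omega> A s (T2 \<omega> B s z)"

text \<open>In the next two definitions \<open>s\<close>, \<open>b\<close>, \<open>a\<close>, \<open>z\<close> stand for the values \<open>\<gamma>\<^sub>k\<close>, \<open>b\<^sub>k\<close>,
  \<open>i \<mapsto> a\<^sub>i\<^sub>,\<^sub>k\<close>, \<open>z\<^sub>k\<close> at one iteration \<open>k\<close>; \<open>\<gamma>\<close> is the limiting stationary step size.\<close>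

definition eps_err ::
    "('n::finite \<Rightarrow> real) \<Rightarrow> ('n \<Rightarrow> 'a::real_vector \<Rightarrow> 'a set) \<Rightarrow> ('a \<Rightarrow> 'a) \<Rightarrow> real
      \<Rightarrow> 'a \<Rightarrow> ('n \<Rightarrow> 'a) \<Rightarrow> 'a ^ 'n \<Rightarrow> 'a ^ 'n" where
  "eps_err \<omega> A B s b a z =
     (T1 \<omega> A s (T2 \<omega> B s z + (\<chi> i. b)) + (\<chi> i. a i)) - T_gfb \<omega> A B s z"

definition pi_err ::
    "('n::finite \<Rightarrow> real) \<Rightarrow> ('n \<Rightarrow> 'a::real_vector \<Rightarrow> 'a set) \<Rightarrow> ('a \<Rightarrow> 'a) \<Rightarrow> real \<Rightarrow> real
      \<Rightarrow> 'a \<Rightarrow> ('n \<Rightarrow> 'a) \<Rightarrow> 'a ^ 'n \<Rightarrow> 'a ^ 'n" where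
  "pi_err \<omega> A B \<gamma> s b a z = (T_gfb \<omega> A B s z - T_gfb \<omega> A B \<gamma> z) + eps_err \<omega> A B s b a z"

definition avg_const :: "real \<Rightarrow> real \<Rightarrow> real" where
  "avg_const \<beta> s = 2 * \<beta> / (4 * \<beta> - s)"

end

theory Submission
  imports Defs
begin

text \<open>
  The iteration operator is averaged in the weighted inner product: a firmly nonexpansive
  map is applied after a forward step along a cocoercive one, and completing a square
  (\<open>firm_after_cocoercive_step\<close>) gives exactly the constant \<open>avg_const \<beta> s\<close>. Relaxed steps below the
  critical relaxation parameter are therefore nonexpansive, and they decrease the squared distance to
  a fixed point by a multiple of the squared residual.

  Changing the step size from \<open>\<gamma>\<close> to \<open>s\<close> moves the operator at \<open>z\<close> by at most a constant multiple of
  \<open>\<bar>s - \<gamma>\<bar> * (1 + norm z)\<close> (\<open>T_gfb_step_size\<close>). Evaluated at a fixed point of the limiting operator this is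
  a summable perturbation, so the distances to such fixed points form almost decreasing sequences. They
  converge, the iterates are bounded, and summing the strict decrease makes the residuals of the
  limiting operator square-summable (\<open>residual_square_summable\<close>). Weak convergence follows by Opial's
  argument (\<open>fejer_asymptotically_regular_weakly_convergent\<close>).

  For the rate, an exact relaxed step does not increase the residual of the operator that it uses
  (\<open>residual_step\<close>); hence the squared residuals of the limiting operator are almost decreasing, with
  increments that stay summable after multiplication by \<open>k + 1\<close>. An almost decreasing summable sequence
  is of order \<open>1 / (k + 1)\<close> (\<open>almost_decreasing_summable_rate\<close>).

  Two existence statements support this. Resolvents of maximal monotone operators are defined
  everywhere (Minty's theorem, \<open>resolvent_unique_solution\<close>), and bounded sequences in a Hilbert space
  have asymptotic centers, which serve here as the candidates for weak limits. Both are
  minimization problems for a paraboloid over a convex set and are solved by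
  \<open>convex_set_paraboloid_minimum\<close>, which needs only completeness.
\<close>

section \<open>Minimizing a paraboloid over a convex set\<close>

text \<open>The function \<open>t + (norm w)\<^sup>2 / 2\<close> is strongly convex in \<open>w\<close>, so by the parallelogram identity
  every minimizing sequence in a convex set is Cauchy, and completeness alone gives a minimizer, at
  a point of the closure. The inequality is the first-order optimality condition there. Two
  choices of \<open>D\<close> give the existence of resolvents and the existence of asymptotic centers.\<close>

lemma convex_set_paraboloid_minimum:
  fixes D :: "('h::{real_inner, complete_space} \<times> real) set"
  assumes "convex D" and "D \<noteq> {}" and bounded: "\<And>w t. (w, t) \<in> D \<Longrightarrow> L \<le> t + (norm w)\<^sup>2 / 2"
  obtains w t where "(w, t) \<in> closure D"
    and "\<And>w' t'. (w', t') \<in> D \<Longrightarrow> t + (norm w)\<^sup>2 \<le> t' + inner w w'"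
proof -
  define Q :: "'h \<times> real \<Rightarrow> real" where "Q c = snd c + (norm (fst c))\<^sup>2 / 2" for c
  define m where "m = Inf (Q ` D)"
  have bdd: "bdd_below (Q ` D)"
    using bounded by (intro bdd_belowI[of _ L]) (auto simp: Q_def)
  have mQ: "m \<le> Q c" if "c \<in> D" for c
    unfolding m_def using that bdd by (simp add: cInf_lower)
  have combination: "Q ((1 - s) *\<^sub>R c + s *\<^sub>R c')
      = (1 - s) * Q c + s * Q c' - s * (1 - s) * (norm (fst c - fst c'))\<^sup>2 / 2" for s c c'
    by (simp add: Q_def power2_norm_eq_inner inner_diff_left inner_diff_right inner_add_left
        inner_add_right inner_commute field_simps)
  have "\<exists>c\<in>D. Q c < m + inverse (real (Suc n))" for n
  proof -
    have "Inf (Q ` D) < m + inverse (real (Suc n))" by (simp add: m_def)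
    then show ?thesis using cInf_less_iff[of "Q ` D"] bdd \<open>D \<noteq> {}\<close> by auto
  qed
  then obtain c where cD: "\<And>n. c n \<in> D" and cQ: "\<And>n. Q (c n) < m + inverse (real (Suc n))"
    by metis
  have close: "(norm (fst (c n) - fst (c k)))\<^sup>2
      \<le> 4 * (inverse (real (Suc n)) + inverse (real (Suc k)))" for n k
  proof -
    have "(1 - 1/2) *\<^sub>R c n + (1/2) *\<^sub>R c k \<in> D"
      using \<open>convex D\<close> cD by (intro convexD_alt) auto
    from mQ[OF this] have "m \<le> Q (c n) / 2 + Q (c k) / 2 - (norm (fst (c n) - fst (c k)))\<^sup>2 / 8"
      unfolding combination by simp
    then show ?thesis using cQ[of n] cQ[of k] by simp
  qed
  have inv0: "(\<lambda>n. inverse (real (Suc n))) \<longlonglongrightarrow> 0"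
    by (rule LIMSEQ_inverse_real_of_nat)
  have "Cauchy (\<lambda>n. fst (c n))"
  proof (rule metric_CauchyI)
    fix e :: real assume "e > 0"
    then obtain N where N: "\<And>n. n \<ge> N \<Longrightarrow> inverse (real (Suc n)) < e\<^sup>2 / 8"
      using order_tendstoD(2)[OF inv0, of "e\<^sup>2 / 8"] by (auto simp: eventually_sequentially)
    have "dist (fst (c n)) (fst (c k)) < e" if "n \<ge> N" "k \<ge> N" for n k
    proof (rule power2_less_imp_less)
      show "(dist (fst (c n)) (fst (c k)))\<^sup>2 < e\<^sup>2"
        using close[of n k] N[OF that(1)] N[OF that(2)] by (simp add: dist_norm)
    qed (use \<open>e > 0\<close> in simp)
    then show "\<exists>M. \<forall>m\<ge>M. \<forall>n\<ge>M. dist (fst (c m)) (fst (c n)) < e" by blast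
  qed
  then obtain w where w: "(\<lambda>n. fst (c n)) \<longlonglongrightarrow> w"
    using Cauchy_convergent convergent_def by blast
  have Qlim: "(\<lambda>n. Q (c n)) \<longlonglongrightarrow> m"
  proof (rule tendsto_sandwich[where f = "\<lambda>_. m"])
    show "(\<lambda>n. m + inverse (real (Suc n))) \<longlonglongrightarrow> m"
      using tendsto_add[OF tendsto_const inv0, of m] by simp
    show "\<forall>\<^sub>F n in sequentially. m \<le> Q (c n)"
      using mQ cD by simp
    show "\<forall>\<^sub>F n in sequentially. Q (c n) \<le> m + inverse (real (Suc n))"
      by (intro always_eventually allI less_imp_le cQ)
  qed simp
  define t where "t = m - (norm w)\<^sup>2 / 2"
  have "(\<lambda>n. Q (c n) - (norm (fst (c n)))\<^sup>2 / 2) \<longlonglongrightarrow> t"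
    unfolding t_def by (intro tendsto_intros Qlim w) simp
  then have t: "(\<lambda>n. snd (c n)) \<longlonglongrightarrow> t" by (simp add: Q_def)
  have lim: "c \<longlonglongrightarrow> (w, t)"
    using tendsto_Pair[OF w t] by simp
  show thesis
  proof
    show "(w, t) \<in> closure D"
      using lim cD closure_sequential by blast
    fix w' t' assume D': "(w', t') \<in> D"
    have first_order: "0 \<le> (Q (w', t') - m) - (1 - s) * (norm (w - w'))\<^sup>2 / 2"
      if s: "0 < s" "s < 1" for s
    proof -
      have "m \<le> (1 - s) * Q (c n) + s * Q (w', t')
          - s * (1 - s) * (norm (fst (c n) - fst (w', t')))\<^sup>2 / 2" for n
        unfolding combination[symmetric]
        using \<open>convex D\<close> cD D' s by (intro mQ convexD_alt) auto
      moreover have "(\<lambda>n. (1 - s) * Q (c n) + s * Q (w', t')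
          - s * (1 - s) * (norm (fst (c n) - fst (w', t')))\<^sup>2 / 2)
        \<longlonglongrightarrow> (1 - s) * m + s * Q (w', t') - s * (1 - s) * (norm (w - fst (w', t')))\<^sup>2 / 2"
        by (intro tendsto_intros Qlim w) simp
      ultimately have "m \<le> (1 - s) * m + s * Q (w', t') - s * (1 - s) * (norm (w - w'))\<^sup>2 / 2"
        by (auto intro: LIMSEQ_le_const)
      then have "0 \<le> s * ((Q (w', t') - m) - (1 - s) * (norm (w - w'))\<^sup>2 / 2)"
        by (simp add: algebra_simps)
      then show ?thesis using s by (simp add: zero_le_mult_iff)
    qed
    have "((\<lambda>s. (Q (w', t') - m) - (1 - s) * (norm (w - w'))\<^sup>2 / 2) \<longlongrightarrow>
        (Q (w', t') - m) - (1 - 0) * (norm (w - w'))\<^sup>2 / 2) (at_right (0::real))"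
      by (intro tendsto_intros) simp
    moreover have "\<forall>\<^sub>F s in at_right (0::real).
        0 \<le> (Q (w', t') - m) - (1 - s) * (norm (w - w'))\<^sup>2 / 2"
      unfolding eventually_at_right_field using first_order by (intro exI[of _ 1]) auto
    ultimately have "0 \<le> (Q (w', t') - m) - (1 - 0) * (norm (w - w'))\<^sup>2 / 2"
      by (rule tendsto_lowerbound) simp
    then show "t + (norm w)\<^sup>2 \<le> t' + inner w w'"
      by (simp add: Q_def t_def power2_norm_eq_inner inner_diff_left inner_diff_right
          inner_commute field_simps)
  qed
qed

section \<open>Resolvents of maximal monotone operators\<close>

text \<open>Minty's surjectivity theorem at the origin. On the convex hull of the points
  \<open>((y, v), inner y v)\<close>, with \<open>(y, v)\<close> in the graph, the last coordinate dominates the inner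
  product of the first two: the two sides agree on generators, and monotonicity survives averaging.
  Hence \<open>t + (norm (y, v))\<^sup>2 / 2\<close>, which is at least \<open>(norm (y + v))\<^sup>2 / 2\<close>, is bounded below, and it
  has a minimizer \<open>((y, v), t)\<close>. Its optimality condition says that \<open>(- v, - y)\<close> is monotonically
  related to the whole graph with slack \<open>(norm (y + v))\<^sup>2\<close>. Maximality puts this point into the graph,
  and testing the condition at the point itself annihilates the slack, so that \<open>v = - y\<close>.\<close>

lemma maximal_monotone_graph_meets_antidiagonal:
  fixes G :: "('a::{real_inner, complete_space} \<times> 'a) set"
  assumes mono: "\<And>y v y' v'. (y, v) \<in> G \<Longrightarrow> (y', v') \<in> G \<Longrightarrow> 0 \<le> inner (v - v') (y - y')"
    and max: "\<And>p u. (\<And>y v. (y, v) \<in> G \<Longrightarrow> 0 \<le> inner (v - u) (y - p)) \<Longrightarrow> (p, u) \<in> G"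
  obtains p where "(p, - p) \<in> G"
proof -
  define H where "H = (\<lambda>(y, v). ((y, v), inner y v)) ` G"
  have "G \<noteq> {}" using max[of 0 0] by auto
  \<comment> \<open>The expression is affine in each of the two points separately, so its sign
    passes from the generators to the hull in one argument and then in the other.\<close>
  have cross: "0 \<le> t + t' - inner (fst w) (snd w') - inner (fst w') (snd w)"
    if "(w, t) \<in> convex hull H" "(w', t') \<in> convex hull H" for w t w' t'
  proof -
    have halfspace: "convex {c :: ('a \<times> 'a) \<times> real.
        0 \<le> snd c + s - inner (fst (fst c)) v - inner u (snd (fst c))}" for s u v
      unfolding convex_alt
    proof (intro ballI allI impI, elim conjE, unfold mem_Collect_eq)
      fix c c' :: "('a \<times> 'a) \<times> real" and r :: real
      assume *: "0 \<le> snd c + s - inner (fst (fst c)) v - inner u (snd (fst c))"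
        "0 \<le> snd c' + s - inner (fst (fst c')) v - inner u (snd (fst c'))" "0 \<le> r" "r \<le> 1"
      have "0 \<le> (1 - r) * (snd c + s - inner (fst (fst c)) v - inner u (snd (fst c)))
          + r * (snd c' + s - inner (fst (fst c')) v - inner u (snd (fst c')))"
        using * by (intro add_nonneg_nonneg mult_nonneg_nonneg) auto
      also have "\<dots> = snd ((1 - r) *\<^sub>R c + r *\<^sub>R c') + s
          - inner (fst (fst ((1 - r) *\<^sub>R c + r *\<^sub>R c'))) v
          - inner u (snd (fst ((1 - r) *\<^sub>R c + r *\<^sub>R c')))"
        by (simp add: inner_add_left inner_add_right algebra_simps)
      finally show "0 \<le> \<dots>" .
    qed
    have graph_hull: "0 \<le> t + inner y v - inner (fst w) v - inner y (snd w)"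
      if "(w, t) \<in> convex hull H" "(y, v) \<in> G" for w t y v
    proof -
      have "convex hull H \<subseteq> {c. 0 \<le> snd c + inner y v - inner (fst (fst c)) v
          - inner y (snd (fst c))}"
        using mono[OF _ that(2)]
        by (intro hull_minimal halfspace)
          (force simp: H_def inner_diff_left inner_diff_right inner_commute)
      then show ?thesis using that(1) by auto
    qed
    have "convex hull H \<subseteq> {c. 0 \<le> snd c + t' - inner (fst (fst c)) (snd w')
        - inner (fst w') (snd (fst c))}"
      using graph_hull[OF that(2)]
      by (intro hull_minimal halfspace) (force simp: H_def inner_commute algebra_simps)
    then show ?thesis using that(1) by auto
  qed
  have above: "convex hull H \<subseteq> {c. inner (fst (fst c)) (snd (fst c)) \<le> snd c}"
    using cross by (force simp: inner_commute)
  have sum_square: "0 \<le> inner y v + (norm (y, v))\<^sup>2 / 2" for y v :: 'a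
    using zero_le_power2[of "norm (y + v)"]
    by (simp add: norm_Pair power2_norm_eq_inner inner_add_left inner_add_right inner_commute
        field_simps)
  obtain w t where wt: "(w, t) \<in> closure (convex hull H)"
    and opt: "\<And>w' t'. (w', t') \<in> convex hull H \<Longrightarrow> t + (norm w)\<^sup>2 \<le> t' + inner w w'"
  proof (rule convex_set_paraboloid_minimum[of "convex hull H" 0])
    show "convex hull H \<noteq> {}" using \<open>G \<noteq> {}\<close> by (auto simp: H_def)
    fix w t assume "(w, t) \<in> convex hull H"
    then have "inner (fst w) (snd w) \<le> t" using above by auto
    then show "0 \<le> t + (norm w)\<^sup>2 / 2" using sum_square[of "fst w" "snd w"] by simp
  qed (auto simp: convex_convex_hull)
  obtain y v where w: "w = (y, v)" by fastforce
  have "closed {c :: ('a \<times> 'a) \<times> real. inner (fst (fst c)) (snd (fst c)) \<le> snd c}"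
    by (intro closed_Collect_le continuous_intros)
  then have t: "inner y v \<le> t"
    using closure_minimal[OF above] wt w by auto
  have gap: "(norm (y + v))\<^sup>2 \<le> inner (v' + y) (y' + v)" if "(y', v') \<in> G" for y' v'
  proof -
    have "((y', v'), inner y' v') \<in> convex hull H"
      using that by (intro hull_inc) (auto simp: H_def)
    from opt[OF this] show ?thesis using t
      by (simp add: w norm_Pair power2_norm_eq_inner inner_add_left inner_add_right inner_commute)
  qed
  have "(- v, - y) \<in> G"
  proof (rule max)
    fix y' v' assume "(y', v') \<in> G"
    then show "0 \<le> inner (v' - - y) (y' - - v)"
      using order_trans[OF zero_le_power2 gap] by simp
  qed
  moreover from gap[OF this] have "(norm (y + v))\<^sup>2 \<le> 0" by simp
  then have "v = - y" by (simp add: eq_neg_iff_add_eq_0 add.commute)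
  ultimately show thesis using that by simp
qed

text \<open>A pair related to the whole graph could be added to it without losing monotonicity.\<close>

lemma maximal_monotone_mem_iff:
  assumes "maximal_monotone A"
  shows "u \<in> A p \<longleftrightarrow> (\<forall>y. \<forall>v\<in>A y. 0 \<le> inner (v - u) (y - p))"
proof
  assume "u \<in> A p"
  then show "\<forall>y. \<forall>v\<in>A y. 0 \<le> inner (v - u) (y - p)"
    using assms by (auto simp: maximal_monotone_def monotone_op_def)
next
  assume related: "\<forall>y. \<forall>v\<in>A y. 0 \<le> inner (v - u) (y - p)"
  define A' where "A' = A(p := insert u (A p))"
  have swap: "inner (u - v) (p - y) = inner (v - u) (y - p)" for y v
    by (metis inner_minus_left inner_minus_right minus_diff_eq minus_minus)
  have "monotone_op A'"
    unfolding monotone_op_def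
  proof (intro allI ballI)
    fix y y' v v' assume "v \<in> A' y" "v' \<in> A' y'"
    then consider "y = p" "v = u" "y' = p" "v' = u" | "y = p" "v = u" "v' \<in> A y'"
      | "v \<in> A y" "y' = p" "v' = u" | "v \<in> A y" "v' \<in> A y'"
      by (auto simp: A'_def split: if_splits)
    then show "0 \<le> inner (v - v') (y - y')"
    proof cases
      case 4 then show ?thesis using assms by (auto simp: maximal_monotone_def monotone_op_def)
    qed (use related swap in auto)
  qed
  moreover have "\<forall>x. A x \<subseteq> A' x" by (auto simp: A'_def)
  ultimately have "A' = A" using assms by (auto simp: maximal_monotone_def)
  then show "u \<in> A p" by (metis A'_def fun_upd_same insertI1)
qed

text \<open>Existence is Minty's theorem for the graph of \<open>c A - x\<close>, uniqueness is monotonicity. Thus the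
  description in the definition of the resolvent is proper, and membership in \<open>A p\<close> is all that
  later arguments use.\<close>

lemma resolvent_unique_solution:
  fixes A :: "'a::{real_inner, complete_space} \<Rightarrow> 'a set"
  assumes A: "maximal_monotone A" and c: "0 < c"
  shows "resolvent (op_scale c A) x = p \<longleftrightarrow> (1 / c) *\<^sub>R (x - p) \<in> A p"
proof -
  have mem: "p \<in> op_inverse (\<lambda>y. {y} + op_scale c A y) x \<longleftrightarrow> (1 / c) *\<^sub>R (x - p) \<in> A p" for p
  proof
    assume "p \<in> op_inverse (\<lambda>y. {y} + op_scale c A y) x"
    then obtain u where "u \<in> A p" "x = p + c *\<^sub>R u"
      by (auto simp: op_inverse_def op_scale_def set_plus_def)
    then show "(1 / c) *\<^sub>R (x - p) \<in> A p" using c by simp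
  next
    assume "(1 / c) *\<^sub>R (x - p) \<in> A p"
    moreover have "x = p + c *\<^sub>R ((1 / c) *\<^sub>R (x - p))" using c by simp
    ultimately show "p \<in> op_inverse (\<lambda>y. {y} + op_scale c A y) x"
      unfolding op_inverse_def op_scale_def set_plus_def by blast
  qed
  have uniq: "p = q" if "(1 / c) *\<^sub>R (x - p) \<in> A p" "(1 / c) *\<^sub>R (x - q) \<in> A q" for p q
  proof -
    have "0 \<le> inner ((1 / c) *\<^sub>R (x - p) - (1 / c) *\<^sub>R (x - q)) (p - q)"
      using A that by (auto simp: maximal_monotone_def monotone_op_def)
    also have "\<dots> = - (1 / c) * (norm (p - q))\<^sup>2"
      by (simp add: power2_norm_eq_inner inner_diff_left inner_diff_right inner_commute
          algebra_simps)
    finally show ?thesis using c by (simp add: field_simps)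
  qed
  define G where "G = {(y, v). (1 / c) *\<^sub>R (v + x) \<in> A y}"
  obtain p0 where "(p0, - p0) \<in> G"
  proof (rule maximal_monotone_graph_meets_antidiagonal[of G])
    fix y v y' v' assume "(y, v) \<in> G" "(y', v') \<in> G"
    then have "0 \<le> inner ((1 / c) *\<^sub>R (v + x) - (1 / c) *\<^sub>R (v' + x)) (y - y')"
      using A by (auto simp: G_def maximal_monotone_def monotone_op_def)
    also have "\<dots> = (1 / c) * inner (v - v') (y - y')"
      by (simp add: inner_diff_left inner_add_left algebra_simps diff_divide_distrib)
    finally show "0 \<le> inner (v - v') (y - y')" using c by (simp add: zero_le_divide_iff)
  next
    fix p u assume related: "\<And>y v. (y, v) \<in> G \<Longrightarrow> 0 \<le> inner (v - u) (y - p)"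
    have "0 \<le> inner (v - (1 / c) *\<^sub>R (u + x)) (y - p)" if "v \<in> A y" for y v
    proof -
      have "(y, c *\<^sub>R v - x) \<in> G" using that c by (simp add: G_def)
      from related[OF this] have "0 \<le> (1 / c) * inner (c *\<^sub>R v - x - u) (y - p)"
        using c by simp
      also have "\<dots> = inner ((1 / c) *\<^sub>R (c *\<^sub>R v - x - u)) (y - p)" by simp
      also have "(1 / c) *\<^sub>R (c *\<^sub>R v - x - u) = v - (1 / c) *\<^sub>R (u + x)"
        using c by (simp add: scaleR_diff_right scaleR_add_right)
      finally show ?thesis .
    qed
    then have "(1 / c) *\<^sub>R (u + x) \<in> A p"
      by (intro iffD2[OF maximal_monotone_mem_iff[OF A]]) blast
    then show "(p, u) \<in> G" by (simp add: G_def)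
  qed
  then have p0: "(1 / c) *\<^sub>R (x - p0) \<in> A p0" by (simp add: G_def)
  have "resolvent (op_scale c A) x = p0"
    unfolding resolvent_def mem using p0 uniq by (intro the_equality)
  then show ?thesis using p0 uniq by metis
qed

section \<open>Asymptotic centers and weak convergence\<close>

text \<open>\<open>R\<close> is the least upper limit along \<open>F\<close> of the squared distances to a point, and \<open>c\<close> is the
  point that attains it. The second clause contains the quadratic growth that comes with strong
  convexity; it makes \<open>c\<close> unique. A filter in place of the index order covers subsequences.\<close>

definition asymptotic_center ::
    "nat filter \<Rightarrow> (nat \<Rightarrow> 'h::real_inner) \<Rightarrow> 'h \<Rightarrow> real \<Rightarrow> bool" where
  "asymptotic_center F x c R \<longleftrightarrow>
     (\<forall>\<epsilon>>0. \<forall>\<^sub>F k in F. (norm (x k - c))\<^sup>2 \<le> R + \<epsilon>) \<and>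
     (\<forall>y \<rho>. (\<forall>\<^sub>F k in F. (norm (x k - y))\<^sup>2 \<le> \<rho>) \<longrightarrow> R + (norm (y - c))\<^sup>2 \<le> \<rho>)"

text \<open>Up to the term \<open>(norm y)\<^sup>2\<close> the squared distance from \<open>x k\<close> to \<open>y\<close> is affine in \<open>y\<close>, so its
  eventual upper bounds form a convex set above which a paraboloid is to be minimized.\<close>

lemma asymptotic_center_exists:
  fixes x :: "nat \<Rightarrow> 'h::{real_inner, complete_space}"
  assumes F: "F \<noteq> bot" and bounded: "\<And>k. norm (x k) \<le> M"
  obtains c R where "asymptotic_center F x c R"
proof -
  have M0: "0 \<le> M" using bounded[of 0] norm_ge_zero order_trans by blast
  define D where "D = {(y, t). \<forall>\<^sub>F k in F. (norm (x k))\<^sup>2 - 2 * inner (x k) y \<le> 2 * t}"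
  have expand: "(norm (x k - y))\<^sup>2 = (norm (x k))\<^sup>2 - 2 * inner (x k) y + (norm y)\<^sup>2" for k y
    by (simp add: power2_norm_eq_inner inner_diff_left inner_diff_right inner_commute)
  have convex: "convex D"
    unfolding convex_alt
  proof (intro ballI allI impI, elim conjE)
    fix p q and s :: real assume pq: "p \<in> D" "q \<in> D" and s: "0 \<le> s" "s \<le> 1"
    from pq have "\<forall>\<^sub>F k in F. (norm (x k))\<^sup>2 - 2 * inner (x k) (fst p) \<le> 2 * snd p"
      "\<forall>\<^sub>F k in F. (norm (x k))\<^sup>2 - 2 * inner (x k) (fst q) \<le> 2 * snd q"
      by (auto simp: D_def)
    then have "\<forall>\<^sub>F k in F. (norm (x k))\<^sup>2 - 2 * inner (x k) (fst ((1 - s) *\<^sub>R p + s *\<^sub>R q))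
        \<le> 2 * snd ((1 - s) *\<^sub>R p + s *\<^sub>R q)"
    proof eventually_elim
      case (elim k)
      have "(1 - s) * ((norm (x k))\<^sup>2 - 2 * inner (x k) (fst p))
          + s * ((norm (x k))\<^sup>2 - 2 * inner (x k) (fst q))
        \<le> (1 - s) * (2 * snd p) + s * (2 * snd q)"
        using elim s by (intro add_mono mult_left_mono) auto
      then show ?case by (simp add: inner_add_right algebra_simps)
    qed
    then show "(1 - s) *\<^sub>R p + s *\<^sub>R q \<in> D"
      by (simp add: D_def case_prod_beta)
  qed
  have "(norm (x k))\<^sup>2 - 2 * inner (x k) 0 \<le> 2 * (M\<^sup>2 / 2)" for k
    using bounded by (simp add: power_mono)
  then have "(0, M\<^sup>2 / 2) \<in> D" unfolding D_def by simp
  then have nonempty: "D \<noteq> {}" by auto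
  have below: "0 \<le> t + (norm w)\<^sup>2 / 2" if "(w, t) \<in> D" for w t
  proof -
    have "\<forall>\<^sub>F k in F. 0 \<le> t + (norm w)\<^sup>2 / 2"
      using that unfolding D_def mem_Collect_eq case_prod_conv
    proof eventually_elim
      case (elim k)
      then show ?case using expand[of k w] zero_le_power2[of "norm (x k - w)"] by linarith
    qed
    then show ?thesis using F by simp
  qed
  from convex_set_paraboloid_minimum[OF convex nonempty below] obtain c t
    where closure: "(c, t) \<in> closure D"
      and opt: "\<And>w' t'. (w', t') \<in> D \<Longrightarrow> t + (norm c)\<^sup>2 \<le> t' + inner c w'"
    by blast
  show thesis
  proof (rule that[of c "2 * t + (norm c)\<^sup>2"], unfold asymptotic_center_def, intro conjI allI impI)
    fix \<epsilon> :: real assume "0 < \<epsilon>"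
    \<comment> \<open>The minimizer lies in the closure of \<open>D\<close> only; boundedness of the sequence makes the
      bounds at nearby points of \<open>D\<close> carry over with an error of at most \<open>\<epsilon>\<close>.\<close>
    define \<delta> where "\<delta> = \<epsilon> / (2 + 2 * M)"
    have "0 < \<delta>" using \<open>0 < \<epsilon>\<close> M0 by (simp add: \<delta>_def)
    then obtain d where d: "d \<in> D" "dist d (c, t) < \<delta>"
      using closure by (auto simp: closure_approachable)
    then have near: "norm (fst d - c) < \<delta>" "\<bar>snd d - t\<bar> < \<delta>"
      using dist_fst_le[of d "(c, t)"] dist_snd_le[of d "(c, t)"] by (auto simp: dist_norm)
    have "\<forall>\<^sub>F k in F. (norm (x k))\<^sup>2 - 2 * inner (x k) (fst d) \<le> 2 * snd d"
      using d by (auto simp: D_def)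
    then show "\<forall>\<^sub>F k in F. (norm (x k - c))\<^sup>2 \<le> 2 * t + (norm c)\<^sup>2 + \<epsilon>"
    proof eventually_elim
      case (elim k)
      have "inner (x k) (fst d - c) \<le> norm (x k) * norm (fst d - c)"
        by (rule norm_cauchy_schwarz)
      also have "\<dots> \<le> M * \<delta>"
        using bounded near M0 by (intro mult_mono) auto
      finally have "inner (x k) (fst d) - inner (x k) c \<le> M * \<delta>"
        by (simp add: inner_diff_right)
      moreover have "\<delta> * (2 + 2 * M) = \<epsilon>"
        using M0 by (simp add: \<delta>_def add_nonneg_eq_0_iff)
      then have "2 * \<delta> + 2 * (M * \<delta>) = \<epsilon>" by (simp add: algebra_simps)
      ultimately show ?case using elim near by (simp add: expand)
    qed
  next
    fix y \<rho> assume "\<forall>\<^sub>F k in F. (norm (x k - y))\<^sup>2 \<le> \<rho>"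
    then have "(y, (\<rho> - (norm y)\<^sup>2) / 2) \<in> D" by (simp add: D_def expand diff_divide_distrib algebra_simps)
    from opt[OF this] show "2 * t + (norm c)\<^sup>2 + (norm (y - c))\<^sup>2 \<le> \<rho>"
      by (simp add: power2_norm_eq_inner inner_diff_left inner_diff_right inner_commute
          field_simps)
  qed
qed

text \<open>If the residuals vanish along \<open>F\<close>, then the sequence is asymptotically at least as close to
  \<open>T c\<close> as to \<open>c\<close>, and quadratic growth leaves no room for \<open>T c\<close> to differ from \<open>c\<close>.\<close>

lemma asymptotic_center_is_fixed_point:
  fixes T :: "'h::real_inner \<Rightarrow> 'h" and x :: "nat \<Rightarrow> 'h"
  assumes nonexpansive: "\<And>x y. norm (T x - T y) \<le> norm (x - y)"
    and bounded: "\<And>k. norm (x k) \<le> M"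
    and residual: "((\<lambda>k. x k - T (x k)) \<longlongrightarrow> 0) F"
    and center: "asymptotic_center F x c R"
  shows "T c = c"
proof -
  define N where "N = 1 + 2 * (M + norm c)"
  have "0 < N" using order_trans[OF norm_ge_zero bounded] by (simp add: N_def add_pos_nonneg)
  have "(norm (T c - c))\<^sup>2 \<le> 0 + \<epsilon>" if "0 < \<epsilon>" for \<epsilon>
  proof -
    have "0 < min 1 (\<epsilon> / (2 * N))" using \<open>0 < \<epsilon>\<close> \<open>0 < N\<close> by simp
    then have "\<forall>\<^sub>F k in F. norm (x k - T (x k)) < min 1 (\<epsilon> / (2 * N))"
      using tendstoD[OF residual, of "min 1 (\<epsilon> / (2 * N))"] by (simp only: dist_norm diff_zero)
    moreover have "\<forall>\<^sub>F k in F. (norm (x k - c))\<^sup>2 \<le> R + \<epsilon> / 2"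
      using center that by (simp add: asymptotic_center_def)
    ultimately have "\<forall>\<^sub>F k in F. (norm (x k - T c))\<^sup>2 \<le> R + \<epsilon>"
    proof eventually_elim
      case (elim k)
      let ?r = "norm (x k - T (x k))" and ?d = "norm (x k - c)"
      have "norm (x k - T c) \<le> ?r + norm (T (x k) - T c)"
        using norm_triangle_ineq[of "x k - T (x k)" "T (x k) - T c"] by simp
      then have "norm (x k - T c) \<le> ?r + ?d" using nonexpansive[of "x k" c] by linarith
      then have "(norm (x k - T c))\<^sup>2 \<le> (?r + ?d)\<^sup>2" by (intro power_mono) auto
      also have "\<dots> = ?r * (?r + 2 * ?d) + ?d\<^sup>2" by (simp add: power2_eq_square algebra_simps)
      also have "?r * (?r + 2 * ?d) \<le> ?r * N"
        using elim(1) bounded[of k] norm_triangle_ineq4[of "x k" c]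
        by (intro mult_left_mono) (auto simp: N_def)
      also have "?r * N \<le> \<epsilon> / (2 * N) * N"
        using elim(1) \<open>0 < N\<close> by (intro mult_right_mono) auto
      also have "\<dots> = \<epsilon> / 2" using \<open>0 < N\<close> by simp
      finally show ?case using elim(2) by simp
    qed
    with center have "R + (norm (T c - c))\<^sup>2 \<le> R + \<epsilon>"
      unfolding asymptotic_center_def by blast
    then show ?thesis by simp
  qed
  then have "(norm (T c - c))\<^sup>2 \<le> 0" by (rule field_le_epsilon)
  then show ?thesis by simp
qed

text \<open>Opial's theorem, with asymptotic centers in place of weak cluster points and the demiclosedness
  principle. The limit is the center \<open>c\<close> of the whole sequence. If \<open>inner (x k - c) v\<close> stayed above
  some \<open>\<epsilon> > 0\<close> along a subsequence, that subsequence would have a center \<open>c'\<close>, also a fixed point.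
  Distances to fixed points converge, so \<open>c\<close> and \<open>c'\<close> are compared by the same limits along the
  sequence and the subsequence, which forces \<open>c' = c\<close>. But then moving the center slightly in
  direction \<open>v\<close> would bring it closer to the subsequence.\<close>

lemma fejer_asymptotically_regular_weakly_convergent:
  fixes T :: "'h::{real_inner, complete_space} \<Rightarrow> 'h" and x :: "nat \<Rightarrow> 'h"
  assumes nonexpansive: "\<And>x y. norm (T x - T y) \<le> norm (x - y)"
    and bounded: "\<And>k. norm (x k) \<le> M"
    and residual: "(\<lambda>k. x k - T (x k)) \<longlonglongrightarrow> 0"
    and fejer: "\<And>w. T w = w \<Longrightarrow> convergent (\<lambda>k. norm (x k - w))"
  obtains l where "T l = l" and "\<And>u. (\<lambda>k. inner (x k) u) \<longlonglongrightarrow> inner l u"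
proof -
  obtain c R where center: "asymptotic_center sequentially x c R"
    using asymptotic_center_exists[of sequentially x M, OF sequentially_bot bounded] by blast
  then have rad: "\<And>\<epsilon>. 0 < \<epsilon> \<Longrightarrow> \<forall>\<^sub>F k in sequentially. (norm (x k - c))\<^sup>2 \<le> R + \<epsilon>"
    and cen: "\<And>y \<rho>. \<forall>\<^sub>F k in sequentially. (norm (x k - y))\<^sup>2 \<le> \<rho> \<Longrightarrow> R + (norm (y - c))\<^sup>2 \<le> \<rho>"
    by (auto simp: asymptotic_center_def)
  have Tc: "T c = c"
    by (rule asymptotic_center_is_fixed_point[OF nonexpansive bounded residual center])
  have upper: "\<forall>\<^sub>F k in sequentially. inner (x k - c) v < \<epsilon>" if "0 < \<epsilon>" for v \<epsilon>
  proof (rule ccontr)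
    assume *: "\<not> ?thesis"
    define K where "K = {k. \<epsilon> \<le> inner (x k - c) v}"
    define F where "F = inf sequentially (principal K)"
    have F: "F \<noteq> bot" and FS: "F \<le> sequentially"
      using * by (auto simp: F_def K_def trivial_limit_def eventually_inf_principal not_le
          elim!: eventually_mono)
    obtain c' R' where center': "asymptotic_center F x c' R'"
      using asymptotic_center_exists[of F x M, OF F bounded] by blast
    then have rad': "\<And>\<epsilon>. 0 < \<epsilon> \<Longrightarrow> \<forall>\<^sub>F k in F. (norm (x k - c'))\<^sup>2 \<le> R' + \<epsilon>"
      and cen': "\<And>y \<rho>. \<forall>\<^sub>F k in F. (norm (x k - y))\<^sup>2 \<le> \<rho> \<Longrightarrow> R' + (norm (y - c'))\<^sup>2 \<le> \<rho>"
      by (auto simp: asymptotic_center_def)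
    have "T c' = c'"
      by (rule asymptotic_center_is_fixed_point[OF nonexpansive bounded _ center'])
        (rule tendsto_mono[OF FS residual])
    then obtain r where r: "(\<lambda>k. norm (x k - c')) \<longlonglongrightarrow> r"
      using fejer by (auto simp: convergent_def)
    have r2: "(\<lambda>k. (norm (x k - c'))\<^sup>2) \<longlonglongrightarrow> r\<^sup>2" using r by (intro tendsto_intros)
    have "r\<^sup>2 \<le> R' + \<delta>" if "0 < \<delta>" for \<delta>
      using tendsto_upperbound[OF tendsto_mono[OF FS r2] rad'[OF that] F] .
    then have rR': "r\<^sup>2 \<le> R'" by (rule field_le_epsilon)
    have "R + (norm (c' - c))\<^sup>2 \<le> r\<^sup>2 + \<delta>" if "0 < \<delta>" for \<delta>
      using order_tendstoD(2)[OF r2, of "r\<^sup>2 + \<delta>"] that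
      by (intro cen) (auto elim!: eventually_mono)
    then have Rr: "R + (norm (c' - c))\<^sup>2 \<le> r\<^sup>2" by (rule field_le_epsilon)
    have "R' + (norm (c - c'))\<^sup>2 \<le> R + \<delta>" if "0 < \<delta>" for \<delta>
      using rad[OF that] FS by (intro cen') (auto simp: filter_leD)
    then have "R' + (norm (c - c'))\<^sup>2 \<le> R" by (rule field_le_epsilon)
    with rR' Rr have "(norm (c - c'))\<^sup>2 \<le> 0"
      unfolding norm_minus_commute[of c' c] by linarith
    then have "c' = c" by simp
    \<comment> \<open>The choice gives \<open>t * t * (norm v)\<^sup>2 = t * \<epsilon> - t * t\<close>, so that the first-order gain
      \<open>2 * t * \<epsilon>\<close> exceeds the radius tolerance \<open>t * \<epsilon>\<close> and the second-order loss together.\<close>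
    define t where "t = \<epsilon> / (1 + (norm v)\<^sup>2)"
    have t0: "0 < t" using \<open>0 < \<epsilon>\<close> by (simp add: t_def add_pos_nonneg)
    have tn: "t * (1 + (norm v)\<^sup>2) = \<epsilon>"
      using add_pos_nonneg[OF zero_less_one zero_le_power2[of "norm v"]] by (simp add: t_def)
    have "R' + (norm (c + t *\<^sub>R v - c'))\<^sup>2 \<le> R' - t * t"
    proof (rule cen')
      have "\<forall>\<^sub>F k in F. (norm (x k - c'))\<^sup>2 \<le> R' + t * \<epsilon>"
        using rad' t0 \<open>0 < \<epsilon>\<close> by simp
      moreover have "\<forall>\<^sub>F k in F. \<epsilon> \<le> inner (x k - c) v"
        by (simp add: F_def K_def eventually_inf_principal)
      ultimately show "\<forall>\<^sub>F k in F. (norm (x k - (c + t *\<^sub>R v)))\<^sup>2 \<le> R' - t * t"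
      proof eventually_elim
        case (elim k)
        have "(norm (x k - (c + t *\<^sub>R v)))\<^sup>2
            = (norm (x k - c))\<^sup>2 - 2 * (t * inner (x k - c) v) + t * (t * (norm v)\<^sup>2)"
          by (simp add: power2_norm_eq_inner inner_diff_left inner_diff_right inner_add_left
              inner_add_right inner_commute algebra_simps)
        moreover have "t * \<epsilon> \<le> t * inner (x k - c) v"
          using elim t0 by (intro mult_left_mono) auto
        moreover have "t * (t * (norm v)\<^sup>2) = t * \<epsilon> - t * t"
          unfolding tn[symmetric] by (simp add: algebra_simps)
        ultimately show ?case using elim(1) unfolding \<open>c' = c\<close> by linarith
      qed
    qed
    moreover have "0 < t * t" using t0 by simp
    ultimately show False using zero_le_power2[of "norm (c + t *\<^sub>R v - c')"] by linarith
  qed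
  have "(\<lambda>k. inner (x k) u) \<longlonglongrightarrow> inner c u" for u
  proof (rule tendstoI)
    fix \<epsilon> :: real assume "0 < \<epsilon>"
    then have "\<forall>\<^sub>F k in sequentially. inner (x k - c) u < \<epsilon>"
      "\<forall>\<^sub>F k in sequentially. inner (x k - c) (- u) < \<epsilon>"
      by (rule upper)+
    then show "\<forall>\<^sub>F k in sequentially. dist (inner (x k) u) (inner c u) < \<epsilon>"
      by eventually_elim (simp add: dist_norm inner_diff_left abs_less_iff)
  qed
  with Tc show thesis by (rule that)
qed

section \<open>Almost decreasing sequences of real numbers\<close>

lemma almost_decreasing_convergent:
  fixes s \<delta> :: "nat \<Rightarrow> real"
  assumes "\<And>k. 0 \<le> s k" "\<And>k. 0 \<le> \<delta> k" and step: "\<And>k. s (Suc k) \<le> s k + \<delta> k" and "summable \<delta>"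
  shows "convergent s"
proof -
  define v where "v k = s k - (\<Sum>j<k. \<delta> j)" for k
  have "decseq v" using step by (intro decseq_SucI) (simp add: v_def algebra_simps)
  moreover have "- suminf \<delta> \<le> v k" for k
    using assms(1)[of k] sum_le_suminf[OF \<open>summable \<delta>\<close>, of "{..<k}"] assms(2) by (simp add: v_def)
  ultimately obtain L where "v \<longlonglongrightarrow> L" using decseq_convergent by metis
  then have "(\<lambda>k. v k + (\<Sum>j<k. \<delta> j)) \<longlonglongrightarrow> L + suminf \<delta>"
    by (intro tendsto_add summable_LIMSEQ \<open>summable \<delta>\<close>)
  then show ?thesis by (auto simp: v_def convergent_def)
qed

lemma summable_decrements:
  fixes s g \<delta> :: "nat \<Rightarrow> real"
  assumes "\<And>k. 0 \<le> s k" "\<And>k. 0 \<le> \<delta> k" "\<And>k. 0 \<le> g k"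
    and step: "\<And>k. s (Suc k) \<le> s k - g k + \<delta> k" and "summable \<delta>"
  shows "summable g"
proof (rule bounded_imp_summable)
  fix n
  have telescope: "s n + (\<Sum>k<n. g k) \<le> s 0 + (\<Sum>k<n. \<delta> k)" for n
  proof (induction n)
    case (Suc n)
    then show ?case using step[of n] by simp
  qed simp
  have "(\<Sum>k\<le>n. g k) = (\<Sum>k<Suc n. g k)" by (simp add: lessThan_Suc_atMost)
  also have "\<dots> \<le> s 0 + suminf \<delta>"
    using telescope[of "Suc n"] assms(1)[of "Suc n"]
      sum_le_suminf[OF \<open>summable \<delta>\<close>, of "{..<Suc n}"] assms(2) by simp
  finally show "(\<Sum>k\<le>n. g k) \<le> s 0 + suminf \<delta>" .
qed (use assms in auto)

lemma summable_mult_bounded: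
  fixes f g :: "nat \<Rightarrow> real"
  assumes "summable f" "\<And>k. 0 \<le> f k" "\<And>k. \<bar>g k\<bar> \<le> C"
  shows "summable (\<lambda>k. f k * g k)"
proof (rule summable_comparison_test')
  show "summable (\<lambda>k. f k * C)" using assms(1) by (rule summable_mult2)
  show "norm (f k * g k) \<le> f k * C" if "k \<ge> 0" for k
    using assms(2,3)[of k] by (simp add: abs_mult mult_left_mono)
qed

lemma summable_bounded:
  fixes f :: "nat \<Rightarrow> real"
  assumes "summable f"
  obtains C where "\<And>k. \<bar>f k\<bar> \<le> C"
proof -
  have "Bseq f" by (rule convergent_imp_Bseq[OF convergentI[OF summable_LIMSEQ_zero[OF assms]]])
  then obtain K where "\<forall>k. norm (f k) \<le> K" by (auto elim: BseqE)
  then show thesis by (intro that[of K]) simp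
qed

text \<open>Weighted telescoping: \<open>(k + 1) s\<^sub>k\<close> grows in one step by at most \<open>s\<^sub>k\<^sub>+\<^sub>1 + (k + 1) \<eta>\<^sub>k\<close>, and both
  contributions are summable.\<close>

lemma almost_decreasing_summable_rate:
  fixes s \<eta> :: "nat \<Rightarrow> real"
  assumes "\<And>k. 0 \<le> s k" "\<And>k. 0 \<le> \<eta> k" and step: "\<And>k. s (Suc k) \<le> s k + \<eta> k"
    and "summable s" "summable (\<lambda>k. real (k + 1) * \<eta> k)"
  obtains M where "\<And>k. real (k + 1) * s k \<le> M"
proof -
  have "real (k + 1) * s k \<le> (\<Sum>j<Suc k. s j) + (\<Sum>j<k. real (j + 1) * \<eta> j)" for k
  proof (induction k)
    case (Suc k)
    have "real (k + 1) * s (Suc k) \<le> real (k + 1) * s k + real (k + 1) * \<eta> k"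
      using mult_left_mono[OF step[of k], of "real (k + 1)"] by (simp add: algebra_simps)
    moreover have "real (Suc k + 1) * s (Suc k) = s (Suc k) + real (k + 1) * s (Suc k)"
      by (simp add: algebra_simps)
    ultimately show ?case using Suc.IH by simp
  qed simp
  also have "\<dots> k \<le> suminf s + (\<Sum>j. real (j + 1) * \<eta> j)" for k
    using assms by (intro add_mono sum_le_suminf) auto
  finally show thesis by (rule that)
qed

section \<open>Perturbed iteration of averaged operators\<close>

text \<open>A relaxed iteration of varying operators \<open>S k\<close> that approach a nonexpansive operator \<open>T\<close>.
  The assumption \<open>relaxed\<close> is what averagedness of \<open>S k\<close> provides when the relaxation parameter
  stays away from its critical value by a margin measured by \<open>\<tau>\<close>. The operators \<open>S k\<close> may have
  fixed points different from those of \<open>T\<close>, and their distance to \<open>T\<close> may grow linearly in the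
  argument, as it does when a step size is changed.\<close>

locale perturbed_averaged_iteration =
  fixes T :: "'h::{real_inner, complete_space} \<Rightarrow> 'h" and S :: "nat \<Rightarrow> 'h \<Rightarrow> 'h"
    and lam d :: "nat \<Rightarrow> real" and \<tau> :: real and \<epsilon> z :: "nat \<Rightarrow> 'h"
  assumes limit_nonexpansive: "norm (T x - T y) \<le> norm (x - y)"
    and step_nonexpansive: "norm (S k x - S k y) \<le> norm (x - y)"
    and relaxed: "(norm ((x - y) - lam k *\<^sub>R ((x - S k x) - (y - S k y))))\<^sup>2
        \<le> (norm (x - y))\<^sup>2 - \<tau> * (norm ((x - S k x) - (y - S k y)))\<^sup>2"
    and tau: "0 < \<tau>" and lam: "0 < lam k" "lam k \<le> 2"
    and close: "norm (S k x - T x) \<le> d k * (1 + norm x)"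
    and d: "0 \<le> d k" "summable d" and \<epsilon>: "summable (\<lambda>k. norm (\<epsilon> k))"
    and iterate: "z (Suc k) = z k + lam k *\<^sub>R (S k (z k) + \<epsilon> k - z k)"
    and fixed_point: "fix_set T \<noteq> {}"
begin

definition relaxation :: "nat \<Rightarrow> 'h \<Rightarrow> 'h" where "relaxation k x = x - lam k *\<^sub>R (x - S k x)"

lemma relaxation_difference: "(norm (relaxation k x - relaxation k y))\<^sup>2
    \<le> (norm (x - y))\<^sup>2 - \<tau> * (norm ((x - S k x) - (y - S k y)))\<^sup>2"
  using relaxed[of x y k] by (simp add: relaxation_def algebra_simps)

lemma relaxation_nonexpansive: "norm (relaxation k x - relaxation k y) \<le> norm (x - y)"
proof (rule power2_le_imp_le)
  have "0 \<le> \<tau> * (norm ((x - S k x) - (y - S k y)))\<^sup>2" using tau by simp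
  then show "(norm (relaxation k x - relaxation k y))\<^sup>2 \<le> (norm (x - y))\<^sup>2" using relaxation_difference[of k x y] by linarith
qed simp

lemma iterate_relaxation: "z (Suc k) = relaxation k (z k) + lam k *\<^sub>R \<epsilon> k"
  by (simp add: iterate relaxation_def algebra_simps)

text \<open>A bound for the part of a step that pulls the iterate away from \<open>p\<close>: the defect of \<open>p\<close> as a fixed point of
  \<open>S k\<close> together with the error, each multiplied by a relaxation parameter of at most 2. The
  operators are compared at the fixed point \<open>p\<close> and not at the iterate; hence the perturbation is
  summable before boundedness of the iterates is known.\<close>

definition perturbation :: "'h \<Rightarrow> nat \<Rightarrow> real"
  where "perturbation p k = 2 * (d k * (1 + norm p) + norm (\<epsilon> k))"

lemma perturbation_nonneg_summable: "0 \<le> perturbation p k" "summable (perturbation p)"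
  using d \<epsilon> unfolding perturbation_def by (auto intro!: summable_mult summable_add summable_mult2)

lemma distance_step:
  assumes "T p = p"
  shows "norm (z (Suc k) - p) \<le> norm (relaxation k (z k) - relaxation k p) + perturbation p k"
proof -
  have "z (Suc k) - p = (relaxation k (z k) - relaxation k p) + lam k *\<^sub>R ((S k p - T p) + \<epsilon> k)"
    using assms by (simp add: iterate_relaxation relaxation_def algebra_simps)
  then have "norm (z (Suc k) - p)
      \<le> norm (relaxation k (z k) - relaxation k p) + lam k * norm ((S k p - T p) + \<epsilon> k)"
    using norm_triangle_ineq[of "relaxation k (z k) - relaxation k p" "lam k *\<^sub>R ((S k p - T p) + \<epsilon> k)"] lam(1)[of k]
    by simp
  also have "lam k * norm ((S k p - T p) + \<epsilon> k) \<le> 2 * (d k * (1 + norm p) + norm (\<epsilon> k))"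
    using lam[of k] close[of k p] norm_triangle_ineq[of "S k p - T p" "\<epsilon> k"]
    by (intro mult_mono) auto
  finally show ?thesis by (simp add: perturbation_def)
qed

lemma quasi_fejer:
  assumes "T p = p"
  shows "norm (z (Suc k) - p) \<le> norm (z k - p) + perturbation p k"
  using distance_step[OF assms, of k] relaxation_nonexpansive[of k "z k" p] by linarith

lemma distance_convergent: "T p = p \<Longrightarrow> convergent (\<lambda>k. norm (z k - p))"
  by (rule almost_decreasing_convergent[OF _ perturbation_nonneg_summable(1) quasi_fejer perturbation_nonneg_summable(2)]) auto

lemma iterates_bounded: obtains M where "\<And>k. norm (z k) \<le> M"
proof -
  obtain p where p: "T p = p" using fixed_point by (auto simp: fix_set_def)
  have "Bseq (\<lambda>k. norm (z k - p))" using distance_convergent[OF p] by (rule convergent_imp_Bseq)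
  then obtain M where M: "\<And>k. norm (z k - p) \<le> M" by (auto simp: Bseq_def)
  have "norm (z k) \<le> M + norm p" for k
    using norm_triangle_ineq[of "z k - p" p] M[of k] by simp
  then show thesis by (rule that)
qed

text \<open>The strict decrease in \<open>relaxed\<close>, summed over the iteration, controls the residuals of \<open>S k\<close>
  relative to their value at \<open>p\<close>. These differ from the residuals of \<open>T\<close> by a square-summable amount,
  because the iterates are bounded by now.\<close>

lemma residual_square_summable: "summable (\<lambda>k. (norm (z k - T (z k)))\<^sup>2)"
proof -
  obtain p where p: "T p = p" using fixed_point by (auto simp: fix_set_def)
  obtain M where M: "\<And>k. norm (z k) \<le> M" using iterates_bounded by blast
  define g where "g k = norm ((z k - S k (z k)) - (p - S k p))" for k
  have zp: "norm (z k - p) \<le> M + norm p" for k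
    using norm_triangle_ineq4[of "z k" p] M[of k] by simp
  have zp0: "0 \<le> M + norm p" by (rule order_trans[OF norm_ge_zero zp[of 0]])
  obtain D where D: "\<And>k. \<bar>perturbation p k\<bar> \<le> D" using summable_bounded[OF perturbation_nonneg_summable(2)] by blast
  have "summable (\<lambda>k. \<tau> * (g k)\<^sup>2)"
  proof (rule summable_decrements)
    show "summable (\<lambda>k. perturbation p k * (2 * (M + norm p) + perturbation p k))"
    proof (rule summable_mult_bounded[OF perturbation_nonneg_summable(2) perturbation_nonneg_summable(1)])
      show "\<bar>2 * (M + norm p) + perturbation p k\<bar> \<le> 2 * (M + norm p) + D" for k
        using D[of k] zp0 by (intro order_trans[OF abs_triangle_ineq] add_mono) auto
    qed
    show "(norm (z (Suc k) - p))\<^sup>2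
        \<le> (norm (z k - p))\<^sup>2 - \<tau> * (g k)\<^sup>2 + perturbation p k * (2 * (M + norm p) + perturbation p k)" for k
    proof -
      have Uzp: "norm (relaxation k (z k) - relaxation k p) \<le> M + norm p"
        using relaxation_nonexpansive[of k "z k" p] zp[of k] by linarith
      have "(norm (z (Suc k) - p))\<^sup>2 \<le> (norm (relaxation k (z k) - relaxation k p) + perturbation p k)\<^sup>2"
        using distance_step[OF p] by (intro power_mono) auto
      also have "\<dots> = (norm (relaxation k (z k) - relaxation k p))\<^sup>2
          + perturbation p k * (2 * norm (relaxation k (z k) - relaxation k p) + perturbation p k)"
        by (simp add: power2_eq_square algebra_simps)
      also have "\<dots> \<le> ((norm (z k - p))\<^sup>2 - \<tau> * (g k)\<^sup>2)
          + perturbation p k * (2 * (M + norm p) + perturbation p k)"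
        unfolding g_def using Uzp perturbation_nonneg_summable(1)[of p k]
        by (intro add_mono relaxation_difference mult_left_mono) auto
      finally show ?thesis .
    qed
    show "0 \<le> perturbation p k * (2 * (M + norm p) + perturbation p k)" for k
      using perturbation_nonneg_summable(1)[of p k] zp0
      by (intro mult_nonneg_nonneg[of "perturbation p k"] add_nonneg_nonneg[of "2 * _"]) auto
  qed (use tau in auto)
  then have sum_g: "summable (\<lambda>k. (g k)\<^sup>2)" using tau by simp
  define C where "C = (1 + M) + (1 + norm p)"
  obtain D' where D': "\<And>k. \<bar>d k\<bar> \<le> D'" using summable_bounded[OF d(2)] by blast
  have "summable (\<lambda>k. d k * d k)" by (rule summable_mult_bounded[OF d(2,1) D'])
  then have majorant: "summable (\<lambda>k. 2 * (g k)\<^sup>2 + 2 * C\<^sup>2 * (d k * d k))"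
    using sum_g by (intro summable_add summable_mult)
  show ?thesis
  proof (rule summable_comparison_test'[OF majorant])
    fix k :: nat
    have "z k - T (z k) = ((z k - S k (z k)) - (p - S k p)) + ((S k (z k) - T (z k)) - (S k p - T p))"
      using p by simp
    then have "norm (z k - T (z k)) \<le> g k + norm ((S k (z k) - T (z k)) - (S k p - T p))"
      unfolding g_def by (metis norm_triangle_ineq)
    moreover have "norm ((S k (z k) - T (z k)) - (S k p - T p)) \<le> d k * C"
    proof -
      have "d k * (1 + norm (z k)) \<le> d k * (1 + M)" using d(1)[of k] M[of k] by (intro mult_left_mono) auto
      then show ?thesis
        using close[of k "z k"] close[of k p]
          norm_triangle_ineq4[of "S k (z k) - T (z k)" "S k p - T p"]
        unfolding C_def distrib_left by linarith
    qed
    ultimately have "norm (z k - T (z k)) \<le> g k + d k * C" by linarith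
    then have "(norm (z k - T (z k)))\<^sup>2 \<le> (g k + d k * C)\<^sup>2" by (intro power_mono) auto
    also have "\<dots> \<le> 2 * (g k)\<^sup>2 + 2 * C\<^sup>2 * (d k * d k)"
      using zero_le_power2[of "g k - d k * C"] by (simp add: power2_eq_square algebra_simps)
    finally show "norm ((norm (z k - T (z k)))\<^sup>2) \<le> 2 * (g k)\<^sup>2 + 2 * C\<^sup>2 * (d k * d k)" by simp
  qed
qed

lemma weakly_convergent:
  obtains l where "l \<in> fix_set T" "\<And>u. (\<lambda>k. inner (z k) u) \<longlonglongrightarrow> inner l u"
proof -
  obtain M where M: "\<And>k. norm (z k) \<le> M" using iterates_bounded by blast
  have "(\<lambda>k. sqrt ((norm (z k - T (z k)))\<^sup>2)) \<longlonglongrightarrow> sqrt 0"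
    by (intro tendsto_real_sqrt summable_LIMSEQ_zero residual_square_summable)
  then have "(\<lambda>k. z k - T (z k)) \<longlonglongrightarrow> 0" by (simp add: tendsto_norm_zero_iff)
  from fejer_asymptotically_regular_weakly_convergent[OF limit_nonexpansive M this distance_convergent]
  show thesis using that by (auto simp: fix_set_def)
qed

text \<open>A relaxation moves \<open>x\<close> by \<open>lam k\<close> times the residual of \<open>S k\<close> at \<open>x\<close>. As it is nonexpansive, a
  second relaxation moves no farther than the first, so an exact step does not increase the residual
  of \<open>S k\<close>, whatever the value of \<open>lam k\<close>. The remaining terms pay for the error and for passing
  from \<open>T\<close> to \<open>S k\<close> and back.\<close>

lemma residual_step:
  "norm (z (Suc k) - T (z (Suc k)))
    \<le> norm (z k - T (z k)) + 4 * norm (\<epsilon> k) + d k * ((1 + norm (z k)) + (1 + norm (z (Suc k))))"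
proof -
  let ?u = "relaxation k (z k)" and ?z = "z (Suc k)"
  have "lam k * norm (?u - S k ?u) = norm (?u - relaxation k ?u)"
    using lam(1)[of k] by (simp add: relaxation_def)
  also have "\<dots> \<le> norm (z k - ?u)" by (rule relaxation_nonexpansive)
  also have "\<dots> = lam k * norm (z k - S k (z k))" using lam(1)[of k] by (simp add: relaxation_def)
  finally have relaxed_step: "norm (?u - S k ?u) \<le> norm (z k - S k (z k))"
    using lam(1)[of k] by simp
  have "norm (?z - ?u) \<le> 2 * norm (\<epsilon> k)"
    using lam[of k] by (simp add: iterate_relaxation mult_right_mono)
  moreover have "norm (?z - S k ?z) \<le> norm (?u - S k ?u) + norm (?z - ?u) + norm (S k ?u - S k ?z)"
  proof -
    have "?z - S k ?z = (?u - S k ?u) + (?z - ?u) + (S k ?u - S k ?z)" by simp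
    then show ?thesis by (metis norm_triangle_le norm_triangle_ineq add_mono order_refl)
  qed
  ultimately have "norm (?z - S k ?z) \<le> norm (z k - S k (z k)) + 4 * norm (\<epsilon> k)"
    using step_nonexpansive[of k ?u ?z] relaxed_step by (simp add: norm_minus_commute)
  moreover have "norm (?z - T ?z) \<le> norm (?z - S k ?z) + norm (S k ?z - T ?z)"
    using norm_triangle_ineq[of "?z - S k ?z" "S k ?z - T ?z"] by simp
  moreover have "norm (z k - S k (z k)) \<le> norm (z k - T (z k)) + norm (S k (z k) - T (z k))"
    using norm_triangle_ineq4[of "z k - T (z k)" "S k (z k) - T (z k)"] by simp
  ultimately show ?thesis
    using close[of k "z k"] close[of k ?z] unfolding distrib_left by linarith
qed

lemma residual_rate:
  assumes "summable (\<lambda>k. real (k + 1) * d k)" "summable (\<lambda>k. real (k + 1) * norm (\<epsilon> k))"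
  obtains C where "\<And>k. real (k + 1) * (norm (z k - T (z k)))\<^sup>2 \<le> C"
proof -
  obtain M where M: "\<And>k. norm (z k) \<le> M" using iterates_bounded by blast
  have M0: "0 \<le> M" using M[of 0] norm_ge_zero order_trans by blast
  define e where "e k = norm (z k - T (z k))" for k
  define \<eta> where "\<eta> k = 4 * norm (\<epsilon> k) + 2 * (1 + M) * d k" for k
  obtain E2 where "\<And>k. \<bar>(e k)\<^sup>2\<bar> \<le> E2"
    using summable_bounded[OF residual_square_summable] unfolding e_def by blast
  then have E: "e k \<le> sqrt E2" for k by (intro real_le_rsqrt) simp
  have E0: "0 \<le> sqrt E2" using order_trans[OF norm_ge_zero E[unfolded e_def]] .
  have \<eta>0: "0 \<le> \<eta> k" for k using d(1)[of k] M0 by (simp add: \<eta>_def)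
  have step: "e (Suc k) \<le> e k + \<eta> k" for k
  proof -
    have "d k * ((1 + norm (z k)) + (1 + norm (z (Suc k)))) \<le> d k * (2 * (1 + M))"
      using d(1)[of k] M[of k] M[of "Suc k"] by (intro mult_left_mono) auto
    then show ?thesis using residual_step[of k] by (simp add: e_def \<eta>_def algebra_simps)
  qed
  have square_step: "(e (Suc k))\<^sup>2 \<le> (e k)\<^sup>2 + 2 * sqrt E2 * \<eta> k" for k
  proof (cases "e (Suc k) \<le> e k")
    case True
    then have "(e (Suc k))\<^sup>2 \<le> (e k)\<^sup>2" by (intro power_mono) (auto simp: e_def)
    then show ?thesis using E0 \<eta>0[of k] by (simp add: add_increasing2)
  next
    case False
    have "(e (Suc k))\<^sup>2 - (e k)\<^sup>2 = (e (Suc k) + e k) * (e (Suc k) - e k)"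
      by (simp add: power2_eq_square algebra_simps)
    also have "\<dots> \<le> (2 * sqrt E2) * \<eta> k"
      using False step[of k] E[of k] E[of "Suc k"] E0 by (intro mult_mono) auto
    finally show ?thesis by simp
  qed
  have "summable (\<lambda>k. 2 * sqrt E2 * (4 * (real (k + 1) * norm (\<epsilon> k))
      + 2 * (1 + M) * (real (k + 1) * d k)))"
    using assms by (intro summable_mult summable_add)
  moreover have "(\<lambda>k. 2 * sqrt E2 * (4 * (real (k + 1) * norm (\<epsilon> k))
      + 2 * (1 + M) * (real (k + 1) * d k))) = (\<lambda>k. real (k + 1) * (2 * sqrt E2 * \<eta> k))"
    by (simp add: \<eta>_def algebra_simps fun_eq_iff)
  ultimately have weighted: "summable (\<lambda>k. real (k + 1) * (2 * sqrt E2 * \<eta> k))"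
    by (simp only:)
  show thesis
  proof (rule almost_decreasing_summable_rate[OF _ _ square_step _ weighted])
    show "summable (\<lambda>k. (e k)\<^sup>2)" unfolding e_def by (rule residual_square_summable)
    show "0 \<le> 2 * sqrt E2 * \<eta> k" for k using E0 \<eta>0[of k] by simp
    fix C assume "\<And>k. real (k + 1) * (e k)\<^sup>2 \<le> C"
    then show thesis by (intro that) (simp add: e_def)
  qed simp
qed

end

section \<open>Firmly nonexpansive maps and the forward-backward composition\<close>

lemma firmly_nonexpansive_bounds:
  fixes t d :: "'h::real_inner"
  assumes "0 \<le> inner t (d - t)"
  shows "norm t \<le> norm d" "norm (d - t) \<le> norm d"
proof -
  have "(norm d)\<^sup>2 = (norm t)\<^sup>2 + 2 * inner t (d - t) + (norm (d - t))\<^sup>2"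
    by (simp add: power2_norm_eq_inner inner_diff_left inner_diff_right inner_commute)
  then have "(norm t)\<^sup>2 \<le> (norm d)\<^sup>2" "(norm (d - t))\<^sup>2 \<le> (norm d)\<^sup>2"
    using assms by simp_all
  then show "norm t \<le> norm d" "norm (d - t) \<le> norm d"
    by (simp_all only: norm_ge_zero power2_le_imp_le)
qed

text \<open>For \<open>d = x - y\<close>, let \<open>c\<close> be the difference of the values of a cocoercive map and \<open>t\<close> the difference
  of the values of a firmly nonexpansive map after the forward step \<open>d - s *\<^sub>R c\<close>. With
  \<open>\<alpha> = 2 * \<beta> / (4 * \<beta> - s)\<close> the factor equals \<open>1 / (2 * \<alpha>)\<close>, so the conclusion says that the composition
  is \<open>\<alpha>\<close>-averaged. Completing the square with \<open>\<beta> *\<^sub>R c - (1/2) *\<^sub>R (d - t)\<close> gives this sharp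
  constant directly.\<close>

lemma firm_after_cocoercive_step:
  fixes c d t :: "'h::real_inner"
  assumes "0 < \<beta>" "0 \<le> s" and coco: "\<beta> * (norm c)\<^sup>2 \<le> inner c d"
    and firm: "0 \<le> inner t ((d - s *\<^sub>R c) - t)"
  shows "(1 - s / (4 * \<beta>)) * (norm (d - t))\<^sup>2 \<le> inner d (d - t)"
proof -
  define r where "r = d - t"
  have d: "d = t + r" by (simp add: r_def)
  have "0 \<le> s / \<beta> * (norm (\<beta> *\<^sub>R c - (1/2) *\<^sub>R r))\<^sup>2"
    using assms by simp
  also have "\<dots> = s * (\<beta> * (norm c)\<^sup>2) - s * inner c r + s / (4 * \<beta>) * (norm r)\<^sup>2"
    using \<open>0 < \<beta>\<close>
    by (simp add: power2_norm_eq_inner inner_diff_left inner_diff_right inner_commute field_simps)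
  also have "s * (\<beta> * (norm c)\<^sup>2) \<le> s * inner c d"
    using coco \<open>0 \<le> s\<close> by (rule mult_left_mono)
  finally have "0 \<le> s * inner c t + s / (4 * \<beta>) * (norm r)\<^sup>2"
    by (simp add: d inner_add_right algebra_simps)
  moreover have "s * inner c t \<le> inner t r"
    using firm by (simp add: d inner_diff_right inner_add_right inner_commute)
  moreover have "inner d r = (norm r)\<^sup>2 + inner t r"
    by (simp add: d inner_add_left power2_norm_eq_inner)
  ultimately show ?thesis unfolding r_def[symmetric] by (simp add: algebra_simps)
qed

lemma resolvent_firmly_nonexpansive:
  fixes A :: "'a::{real_inner, complete_space} \<Rightarrow> 'a set"
  assumes A: "maximal_monotone A" and c: "0 < c"
  shows "0 \<le> inner (resolvent (op_scale c A) x - resolvent (op_scale c A) y)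
    ((x - y) - (resolvent (op_scale c A) x - resolvent (op_scale c A) y))"
proof -
  define p q where "p = resolvent (op_scale c A) x" and "q = resolvent (op_scale c A) y"
  have "(1 / c) *\<^sub>R (x - p) \<in> A p" "(1 / c) *\<^sub>R (y - q) \<in> A q"
    using resolvent_unique_solution[OF A c] by (auto simp: p_def q_def)
  then have "0 \<le> inner ((1 / c) *\<^sub>R (x - p) - (1 / c) *\<^sub>R (y - q)) (p - q)"
    using A by (auto simp: maximal_monotone_def monotone_op_def)
  also have "(1 / c) *\<^sub>R (x - p) - (1 / c) *\<^sub>R (y - q) = (1 / c) *\<^sub>R ((x - y) - (p - q))"
    by (simp add: algebra_simps)
  finally show ?thesis using c
    by (simp add: p_def[symmetric] q_def[symmetric] zero_le_divide_iff inner_commute)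
qed

text \<open>For the two values \<open>p\<close> and \<open>q\<close>, the monotonicity inequality multiplied by \<open>c\<close> compares \<open>x - p\<close> with
  \<open>(c / c') *\<^sub>R (x - q)\<close>. These would differ by \<open>p - q\<close> alone if the parameters agreed, so the rest
  measures the change of parameter.\<close>

lemma resolvent_step_size:
  fixes A :: "'a::{real_inner, complete_space} \<Rightarrow> 'a set"
  assumes A: "maximal_monotone A" and "0 < c" "0 < c'"
  shows "norm (resolvent (op_scale c A) x - resolvent (op_scale c' A) x)
    \<le> \<bar>c - c'\<bar> / c' * norm (x - resolvent (op_scale c' A) x)"
proof -
  define p q where "p = resolvent (op_scale c A) x" and "q = resolvent (op_scale c' A) x"
  have "(1 / c) *\<^sub>R (x - p) \<in> A p" "(1 / c') *\<^sub>R (x - q) \<in> A q"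
    using resolvent_unique_solution[OF A] assms(2,3) by (auto simp: p_def q_def)
  then have "0 \<le> inner ((1 / c) *\<^sub>R (x - p) - (1 / c') *\<^sub>R (x - q)) (p - q)"
    using A by (auto simp: maximal_monotone_def monotone_op_def)
  then have "0 \<le> inner (c *\<^sub>R ((1 / c) *\<^sub>R (x - p) - (1 / c') *\<^sub>R (x - q))) (p - q)"
    using \<open>0 < c\<close> by simp
  also have "c *\<^sub>R ((1 / c) *\<^sub>R (x - p) - (1 / c') *\<^sub>R (x - q))
      = ((c' - c) / c') *\<^sub>R (x - q) - (p - q)"
    using \<open>0 < c\<close> \<open>0 < c'\<close> by (simp add: diff_divide_distrib scaleR_diff_left algebra_simps)
  finally have "(norm (p - q))\<^sup>2 \<le> inner (((c' - c) / c') *\<^sub>R (x - q)) (p - q)"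
    by (simp add: inner_diff_left power2_norm_eq_inner)
  also have "\<dots> \<le> norm (((c' - c) / c') *\<^sub>R (x - q)) * norm (p - q)" by (rule norm_cauchy_schwarz)
  finally have "norm (p - q) * norm (p - q)
      \<le> norm (((c' - c) / c') *\<^sub>R (x - q)) * norm (p - q)"
    by (simp only: power2_eq_square)
  then have "norm (p - q) \<le> norm (((c' - c) / c') *\<^sub>R (x - q))"
    by (cases "p = q") (simp_all only: mult_le_cancel_right zero_less_norm_iff, auto)
  then show ?thesis using \<open>0 < c'\<close>
    by (simp add: p_def[symmetric] q_def[symmetric] abs_minus_commute)
qed

section \<open>The generalized forward-backward operator in the weighted product\<close>

text \<open>An isometry from the weighted product onto the product with its usual inner product.\<close>

definition weight_embed :: "('n::finite \<Rightarrow> real) \<Rightarrow> ('a::real_vector) ^ 'n \<Rightarrow> 'a ^ 'n" where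
  "weight_embed \<omega> x = (\<chi> i. sqrt (\<omega> i) *\<^sub>R x $ i)"

lemma weight_embed_linear:
  "weight_embed \<omega> (x + y) = weight_embed \<omega> x + weight_embed \<omega> y"
  "weight_embed \<omega> (x - y) = weight_embed \<omega> x - weight_embed \<omega> y"
  "weight_embed \<omega> (c *\<^sub>R x) = c *\<^sub>R weight_embed \<omega> x"
  by (simp_all add: weight_embed_def vec_eq_iff scaleR_add_right scaleR_diff_right)

lemma wavg_linear:
  "wavg \<omega> (x + y) = wavg \<omega> x + wavg \<omega> y"
  "wavg \<omega> (x - y) = wavg \<omega> x - wavg \<omega> y"
  by (simp_all add: wavg_def scaleR_add_right scaleR_diff_right sum.distrib sum_subtractf
      scaleR_sum_right mult.commute)

locale generalized_forward_backward =
  fixes B :: "'a::{real_inner, complete_space} \<Rightarrow> 'a" and A :: "'n::finite \<Rightarrow> 'a \<Rightarrow> 'a set"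
    and \<omega> :: "'n \<Rightarrow> real" and \<beta> :: real
  assumes cocoercive: "cocoercive \<beta> B" and maximal: "maximal_monotone (A i)"
    and weight: "0 < \<omega> i" and weight_sum: "(\<Sum>i\<in>UNIV. \<omega> i) = 1"
begin

abbreviation W :: "'a ^ 'n \<Rightarrow> 'a ^ 'n" where "W \<equiv> weight_embed \<omega>"

definition W_inv :: "'a ^ 'n \<Rightarrow> 'a ^ 'n" where "W_inv x = (\<chi> i. (1 / sqrt (\<omega> i)) *\<^sub>R x $ i)"

lemma W_inv [simp]: "W_inv (W x) = x" "W (W_inv x) = x"
  using weight by (auto simp: W_inv_def weight_embed_def vec_eq_iff less_imp_neq[symmetric])

lemma beta: "0 < \<beta>"
  using cocoercive by (simp add: cocoercive_def)

lemma weight_le_one: "\<omega> i \<le> 1"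
proof -
  have "\<omega> i \<le> (\<Sum>i\<in>UNIV. \<omega> i)" by (rule member_le_sum) (use weight in \<open>auto intro: less_imp_le\<close>)
  then show ?thesis by (simp add: weight_sum)
qed

lemma inner_W: "inner (W x) (W y) = (\<Sum>i\<in>UNIV. \<omega> i * inner (x $ i) (y $ i))"
proof -
  have "sqrt (\<omega> i) * (sqrt (\<omega> i) * c) = \<omega> i * c" for i c
    using weight[of i] by (simp flip: mult.assoc)
  then show ?thesis
    by (simp only: inner_vec_def weight_embed_def vec_lambda_beta inner_scaleR_left inner_scaleR_right)
qed

lemma winner_W: "winner \<omega> x y = inner (W x) (W y)"
  by (simp add: inner_W winner_def)

lemma wnorm_W: "wnorm \<omega> x = norm (W x)"
  by (simp add: wnorm_def winner_W norm_eq_sqrt_inner)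

lemma inner_W_diagonal: "inner (W x) (W (\<chi> i. c)) = inner (wavg \<omega> x) c"
  by (simp add: inner_W wavg_def inner_sum_left)

lemma wavg_diagonal: "wavg \<omega> (\<chi> i. c) = c"
  by (simp add: wavg_def scaleR_left.sum[symmetric] weight_sum)

lemma norm_W_diagonal: "norm (W (\<chi> i. c)) = norm c"
  by (simp add: norm_eq_sqrt_inner inner_W_diagonal wavg_diagonal)

lemma norm_W_le_sum: "norm (W x) \<le> (\<Sum>i\<in>UNIV. norm (x $ i))"
proof -
  have "norm (W x) \<le> (\<Sum>i\<in>UNIV. norm (W x $ i))"
    unfolding norm_vec_def by (rule L2_set_le_sum) simp
  also have "\<dots> \<le> (\<Sum>i\<in>UNIV. norm (x $ i))"
    using weight weight_le_one
    by (intro sum_mono) (auto simp: weight_embed_def less_imp_le mult_left_le_one_le)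
  finally show ?thesis .
qed

lemma R_S_difference: "R_S \<omega> x - R_S \<omega> y = 2 *\<^sub>R (P_S \<omega> x - P_S \<omega> y) - (x - y)"
  by (simp add: R_S_def algebra_simps)

lemma P_S_difference: "P_S \<omega> x - P_S \<omega> y = (\<chi> i. wavg \<omega> (x - y))"
  by (simp add: P_S_def vec_eq_iff wavg_linear)

text \<open>\<open>P_S \<omega>\<close> is the orthogonal projection onto the diagonal with respect to the weighted inner
  product.\<close>

lemma P_S_orthogonal:
  "inner (W (P_S \<omega> x - P_S \<omega> y)) (W (x - y))
    = inner (W (P_S \<omega> x - P_S \<omega> y)) (W (P_S \<omega> x - P_S \<omega> y))"
  unfolding P_S_difference
  by (subst inner_commute) (simp add: inner_W_diagonal wavg_diagonal)

lemma norm_W_R_S: "norm (W (R_S \<omega> x)) = norm (W x)"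
proof -
  have P0: "P_S \<omega> 0 = 0" by (simp add: P_S_def wavg_def vec_eq_iff)
  have "inner (W (P_S \<omega> x)) (W x) = inner (W (P_S \<omega> x)) (W (P_S \<omega> x))"
    using P_S_orthogonal[of x 0] by (simp add: P0)
  then show ?thesis
    by (simp add: norm_eq_sqrt_inner R_S_def weight_embed_linear inner_diff_left
        inner_diff_right inner_commute)
qed

lemma J_A_firmly_nonexpansive:
  assumes "0 < s"
  shows "0 \<le> inner (W (J_A \<omega> A s x - J_A \<omega> A s y))
    (W (x - y) - W (J_A \<omega> A s x - J_A \<omega> A s y))"
  unfolding weight_embed_linear(2)[symmetric] inner_W
proof (intro sum_nonneg mult_nonneg_nonneg)
  fix i show "0 \<le> inner ((J_A \<omega> A s x - J_A \<omega> A s y) $ i)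
      ((x - y - (J_A \<omega> A s x - J_A \<omega> A s y)) $ i)"
    using resolvent_firmly_nonexpansive[OF maximal, of "s / \<omega> i" i] assms weight
    by (simp add: J_A_def)
qed (use weight in \<open>auto intro: less_imp_le\<close>)

lemma T1_eq: "T1 \<omega> A s z = J_A \<omega> A s (R_S \<omega> z) - P_S \<omega> z + z"
proof -
  have "R_A \<omega> A s (R_S \<omega> z) + z = 2 *\<^sub>R (J_A \<omega> A s (R_S \<omega> z) - P_S \<omega> z + z)"
    by (simp add: R_A_def R_S_def scaleR_2 algebra_simps)
  then show ?thesis by (simp add: T1_def)
qed

text \<open>With \<open>j\<close>, \<open>q\<close>, \<open>h\<close> as in the proof, orthogonality of the projection reduces the expression
  to \<open>inner j (2 *\<^sub>R q - h - j)\<close>, and \<open>2 *\<^sub>R q - h\<close> is the difference of the reflected arguments of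
  the resolvent.\<close>

lemma T1_firmly_nonexpansive:
  assumes "0 < s"
  shows "0 \<le> inner (W (T1 \<omega> A s x - T1 \<omega> A s y)) (W (x - y) - W (T1 \<omega> A s x - T1 \<omega> A s y))"
proof -
  define j q h where "j = W (J_A \<omega> A s (R_S \<omega> x) - J_A \<omega> A s (R_S \<omega> y))"
    and "q = W (P_S \<omega> x - P_S \<omega> y)" and "h = W (x - y)"
  have "0 \<le> inner j ((2 *\<^sub>R q - h) - j)"
    using J_A_firmly_nonexpansive[OF assms, of "R_S \<omega> x" "R_S \<omega> y"]
    unfolding R_S_difference weight_embed_linear(2)[of _ "2 *\<^sub>R _"]
    by (simp add: weight_embed_linear j_def q_def h_def)
  moreover have "inner q h = inner q q"
    unfolding q_def h_def by (rule P_S_orthogonal)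
  moreover have "W (T1 \<omega> A s x - T1 \<omega> A s y) = j - q + h"
    by (simp add: T1_eq weight_embed_linear j_def q_def h_def algebra_simps)
  ultimately show ?thesis unfolding h_def[symmetric]
    by (simp only:) (simp add: inner_diff_left inner_diff_right inner_add_left inner_commute algebra_simps)
qed

lemma B_S_cocoercive:
  "\<beta> * (norm (W (B_S \<omega> B x - B_S \<omega> B y)))\<^sup>2 \<le> inner (W (B_S \<omega> B x - B_S \<omega> B y)) (W (x - y))"
proof -
  have B: "B_S \<omega> B x - B_S \<omega> B y = (\<chi> i. B (wavg \<omega> x) - B (wavg \<omega> y))"
    by (simp add: B_S_def vec_eq_iff)
  show ?thesis using cocoercive unfolding B norm_W_diagonal
    by (subst inner_commute)
      (simp add: inner_W_diagonal wavg_linear cocoercive_def inner_commute)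
qed

lemma T2_difference:
  "W (T2 \<omega> B s x - T2 \<omega> B s y) = W (x - y) - s *\<^sub>R W (B_S \<omega> B x - B_S \<omega> B y)"
  by (simp add: T2_def weight_embed_linear algebra_simps)

lemma residual_cocoercive:
  assumes "0 < s"
    and "t = W (T_gfb \<omega> A B s x - T_gfb \<omega> A B s y)"
  shows "(1 - s / (4 * \<beta>)) * (norm (W (x - y) - t))\<^sup>2 \<le> inner (W (x - y)) (W (x - y) - t)"
proof (rule firm_after_cocoercive_step[OF beta _ B_S_cocoercive])
  show "0 \<le> inner t (W (x - y) - s *\<^sub>R W (B_S \<omega> B x - B_S \<omega> B y) - t)"
    unfolding assms(2) T_gfb_def T2_difference[symmetric]
    by (rule T1_firmly_nonexpansive[OF assms(1)])
qed (use assms in simp)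

lemma T_gfb_relaxed:
  assumes "0 < s" "0 \<le> \<mu>" and \<tau>: "\<tau> \<le> \<mu> * (1 / avg_const \<beta> s - \<mu>)"
    and t: "t = W (T_gfb \<omega> A B s x - T_gfb \<omega> A B s y)"
  shows "(norm (W (x - y) - \<mu> *\<^sub>R (W (x - y) - t)))\<^sup>2
    \<le> (norm (W (x - y)))\<^sup>2 - \<tau> * (norm (W (x - y) - t))\<^sup>2"
proof -
  define d r where "d = W (x - y)" and "r = W (x - y) - t"
  have "(norm (d - \<mu> *\<^sub>R r))\<^sup>2 = (norm d)\<^sup>2 - 2 * \<mu> * inner d r + \<mu> * \<mu> * (norm r)\<^sup>2"
    by (simp add: power2_norm_eq_inner inner_diff_left inner_diff_right inner_commute algebra_simps)
  moreover have "2 * \<mu> * ((1 - s / (4 * \<beta>)) * (norm r)\<^sup>2) \<le> 2 * \<mu> * inner d r"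
    using residual_cocoercive[OF \<open>0 < s\<close> t] \<open>0 \<le> \<mu>\<close>
    unfolding d_def r_def by (intro mult_left_mono) auto
  moreover have "2 * \<mu> * ((1 - s / (4 * \<beta>)) * (norm r)\<^sup>2) - \<mu> * \<mu> * (norm r)\<^sup>2
      = \<mu> * (1 / avg_const \<beta> s - \<mu>) * (norm r)\<^sup>2"
    using beta by (simp add: avg_const_def field_simps)
  moreover have "\<tau> * (norm r)\<^sup>2 \<le> \<mu> * (1 / avg_const \<beta> s - \<mu>) * (norm r)\<^sup>2"
    using \<tau> by (intro mult_right_mono) auto
  ultimately show ?thesis unfolding d_def r_def by linarith
qed

lemma T_gfb_nonexpansive:
  assumes "0 < s" "s < 2 * \<beta>"
  shows "norm (W (T_gfb \<omega> A B s x - T_gfb \<omega> A B s y)) \<le> norm (W (x - y))"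
proof (rule power2_le_imp_le)
  have "1 / avg_const \<beta> s - 1 = 1 - s / (2 * \<beta>)"
    using beta by (simp add: avg_const_def field_simps)
  then have "0 \<le> 1 * (1 / avg_const \<beta> s - 1)" using assms beta by simp
  from T_gfb_relaxed[OF \<open>0 < s\<close> _ this refl, of x y]
  show "(norm (W (T_gfb \<omega> A B s x - T_gfb \<omega> A B s y)))\<^sup>2 \<le> (norm (W (x - y)))\<^sup>2" by simp
qed simp

lemma norm_J_A_step_size:
  assumes "0 < s" "0 < \<gamma>"
  shows "norm (W (J_A \<omega> A s w - J_A \<omega> A \<gamma> w)) \<le> \<bar>s - \<gamma>\<bar> / \<gamma> * norm (W (w - J_A \<omega> A \<gamma> w))"
proof -
  have component: "norm (W (J_A \<omega> A s w - J_A \<omega> A \<gamma> w) $ i)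
      \<le> norm (((\<bar>s - \<gamma>\<bar> / \<gamma>) *\<^sub>R W (w - J_A \<omega> A \<gamma> w)) $ i)" for i
  proof -
    have "\<bar>s / \<omega> i - \<gamma> / \<omega> i\<bar> / (\<gamma> / \<omega> i) = \<bar>s - \<gamma>\<bar> / \<gamma>"
      using weight[of i] by (simp add: diff_divide_distrib[symmetric])
    with resolvent_step_size[OF maximal, of "s / \<omega> i" "\<gamma> / \<omega> i" i "w $ i"] assms weight[of i]
    have "norm ((J_A \<omega> A s w - J_A \<omega> A \<gamma> w) $ i) \<le> \<bar>s - \<gamma>\<bar> / \<gamma> * norm ((w - J_A \<omega> A \<gamma> w) $ i)"
      by (simp add: J_A_def)
    from mult_left_mono[OF this, of "sqrt (\<omega> i)"] show ?thesis
      using weight[of i] assms by (simp add: weight_embed_def mult_ac)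
  qed
  have "norm (W (J_A \<omega> A s w - J_A \<omega> A \<gamma> w)) \<le> norm ((\<bar>s - \<gamma>\<bar> / \<gamma>) *\<^sub>R W (w - J_A \<omega> A \<gamma> w))"
    unfolding norm_vec_def[of "W _"] norm_vec_def[of "_ *\<^sub>R _"]
    using component by (intro L2_set_mono) auto
  then show ?thesis using assms by simp
qed

text \<open>Changing \<open>s\<close> into \<open>\<gamma>\<close> in the resolvent costs \<open>\<bar>s - \<gamma>\<bar> / \<gamma>\<close> times the displacement that the
  \<open>\<gamma>\<close>-resolvent produces, and in the forward step \<open>\<bar>s - \<gamma>\<bar>\<close> times the norm of the forward operator.
  Both grow at most linearly in \<open>z\<close>, with constants \<open>c2\<close> and \<open>c1\<close> that are uniform in \<open>s\<close>.\<close>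

lemma T_gfb_step_size:
  assumes "0 < \<gamma>" "\<gamma> < 2 * \<beta>"
  obtains K where "0 \<le> K" and "\<And>s z. 0 < s \<Longrightarrow> s < 2 * \<beta> \<Longrightarrow>
    norm (W (T_gfb \<omega> A B s z - T_gfb \<omega> A B \<gamma> z)) \<le> \<bar>s - \<gamma>\<bar> * K * (1 + norm (W z))"
proof -
  define c1 where "c1 = norm (W (B_S \<omega> B 0)) + 1 / \<beta>"
  define c2 where "c2 = 1 + 2 * \<beta> * c1 + norm (W (J_A \<omega> A \<gamma> 0))"
  have c1: "0 \<le> c1" using beta by (simp add: c1_def)
  have c2: "0 \<le> c2" using beta c1 by (simp add: c2_def)
  have B_bound: "norm (W (B_S \<omega> B z)) \<le> c1 * (1 + norm (W z))" for z
  proof -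
    let ?b = "norm (W (B_S \<omega> B z - B_S \<omega> B 0))"
    have "\<beta> * ?b\<^sup>2 \<le> ?b * norm (W z)"
      using order_trans[OF B_S_cocoercive norm_cauchy_schwarz, of z 0] by simp
    then have "\<beta> * ?b \<le> norm (W z)"
      by (cases "?b = 0") (auto simp: power2_eq_square)
    then have "?b \<le> 1 / \<beta> * norm (W z)" using beta by (simp add: field_simps)
    moreover have "norm (W (B_S \<omega> B z)) \<le> ?b + norm (W (B_S \<omega> B 0))"
      using norm_triangle_ineq[of "W (B_S \<omega> B z - B_S \<omega> B 0)" "W (B_S \<omega> B 0)"]
      by (simp add: weight_embed_linear)
    moreover have "0 \<le> norm (W (B_S \<omega> B 0)) * norm (W z)" "0 \<le> 1 / \<beta>" using beta by auto
    ultimately show ?thesis unfolding c1_def distrib_left distrib_right by linarith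
  qed
  show thesis
  proof (rule that)
    show "0 \<le> c2 / \<gamma> + c1" using c1 c2 assms by simp
    fix s z assume s: "0 < s" "s < 2 * \<beta>"
    define n where "n = 1 + norm (W z)"
    define v where "v = T2 \<omega> B s z"
    define w where "w = R_S \<omega> v"
    have "norm (W v) \<le> norm (W z) + s * norm (W (B_S \<omega> B z))"
      using norm_triangle_ineq4[of "W z" "s *\<^sub>R W (B_S \<omega> B z)"] s
      by (simp add: v_def T2_def weight_embed_linear)
    also have "s * norm (W (B_S \<omega> B z)) \<le> 2 * \<beta> * (c1 * n)"
      using B_bound[of z] s c1 beta by (intro mult_mono) (auto simp: n_def)
    also have "norm (W z) \<le> n" by (simp add: n_def)
    finally have v: "norm (W v) \<le> (1 + 2 * \<beta> * c1) * n" by (simp add: algebra_simps)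
    have "norm (W (w - 0) - W (J_A \<omega> A \<gamma> w - J_A \<omega> A \<gamma> 0)) \<le> norm (W (w - 0))"
      by (rule firmly_nonexpansive_bounds(2)[OF J_A_firmly_nonexpansive[OF assms(1)]])
    moreover have "W (w - J_A \<omega> A \<gamma> w)
        = (W (w - 0) - W (J_A \<omega> A \<gamma> w - J_A \<omega> A \<gamma> 0)) - W (J_A \<omega> A \<gamma> 0)"
      by (simp add: weight_embed_linear)
    ultimately have "norm (W (w - J_A \<omega> A \<gamma> w)) \<le> norm (W w) + norm (W (J_A \<omega> A \<gamma> 0))"
      using norm_triangle_ineq4[of "W (w - 0) - W (J_A \<omega> A \<gamma> w - J_A \<omega> A \<gamma> 0)" "W (J_A \<omega> A \<gamma> 0)"]
      by simp
    also have "norm (W w) \<le> (1 + 2 * \<beta> * c1) * n" using v by (simp add: w_def norm_W_R_S)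
    also have "norm (W (J_A \<omega> A \<gamma> 0)) \<le> norm (W (J_A \<omega> A \<gamma> 0)) * n"
      by (simp add: n_def mult_le_cancel_left1)
    finally have w: "norm (W (w - J_A \<omega> A \<gamma> w)) \<le> c2 * n" by (simp add: c2_def algebra_simps)
    have "norm (W (T1 \<omega> A s v - T1 \<omega> A \<gamma> v)) \<le> \<bar>s - \<gamma>\<bar> / \<gamma> * norm (W (w - J_A \<omega> A \<gamma> w))"
      using norm_J_A_step_size[OF s(1) assms(1), of w] by (simp add: T1_eq w_def)
    also have "\<dots> \<le> \<bar>s - \<gamma>\<bar> / \<gamma> * (c2 * n)"
      using w assms by (intro mult_left_mono) auto
    finally have backward: "norm (W (T1 \<omega> A s v - T1 \<omega> A \<gamma> v)) \<le> \<bar>s - \<gamma>\<bar> / \<gamma> * (c2 * n)" .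
    have "norm (W (T1 \<omega> A \<gamma> v - T1 \<omega> A \<gamma> (T2 \<omega> B \<gamma> z))) \<le> norm (W (v - T2 \<omega> B \<gamma> z))"
      by (rule firmly_nonexpansive_bounds(1)[OF T1_firmly_nonexpansive[OF assms(1)]])
    also have "v - T2 \<omega> B \<gamma> z = (\<gamma> - s) *\<^sub>R B_S \<omega> B z"
      by (simp add: v_def T2_def algebra_simps)
    also have "norm (W \<dots>) \<le> \<bar>s - \<gamma>\<bar> * (c1 * n)"
      using B_bound[of z] by (simp add: weight_embed_linear n_def abs_minus_commute mult_left_mono)
    finally have forward:
      "norm (W (T1 \<omega> A \<gamma> v - T1 \<omega> A \<gamma> (T2 \<omega> B \<gamma> z))) \<le> \<bar>s - \<gamma>\<bar> * (c1 * n)" .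
    have "norm (W (T_gfb \<omega> A B s z - T_gfb \<omega> A B \<gamma> z))
        \<le> norm (W (T1 \<omega> A s v - T1 \<omega> A \<gamma> v)) + norm (W (T1 \<omega> A \<gamma> v - T1 \<omega> A \<gamma> (T2 \<omega> B \<gamma> z)))"
      using norm_triangle_ineq[of "W (T1 \<omega> A s v - T1 \<omega> A \<gamma> v)"
          "W (T1 \<omega> A \<gamma> v - T1 \<omega> A \<gamma> (T2 \<omega> B \<gamma> z))"]
      by (simp add: T_gfb_def v_def weight_embed_linear)
    also have "\<dots> \<le> \<bar>s - \<gamma>\<bar> / \<gamma> * (c2 * n) + \<bar>s - \<gamma>\<bar> * (c1 * n)"
      using backward forward by (rule add_mono)
    also have "\<dots> = \<bar>s - \<gamma>\<bar> * (c2 / \<gamma> + c1) * n" by (simp add: algebra_simps)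
    finally show "norm (W (T_gfb \<omega> A B s z - T_gfb \<omega> A B \<gamma> z))
        \<le> \<bar>s - \<gamma>\<bar> * (c2 / \<gamma> + c1) * (1 + norm (W z))"
      by (simp add: n_def)
  qed
qed

text \<open>Given \<open>u i \<in> A i x\<close> with \<open>B x + (\<Sum>i\<in>UNIV. u i) = 0\<close>, the point
  \<open>z i = x - \<gamma> *\<^sub>R B x - (\<gamma> / \<omega> i) *\<^sub>R u i\<close> has weighted average \<open>x\<close>, and the reflected forward step
  sends its \<open>i\<close>-th component to \<open>x + (\<gamma> / \<omega> i) *\<^sub>R u i\<close>, whose resolvent is \<open>x\<close>.\<close>

lemma fix_set_T_gfb_nonempty:
  assumes "zer (\<lambda>x. {B x} + (\<Sum>i\<in>UNIV. A i x)) \<noteq> {}" and "0 < \<gamma>"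
  shows "fix_set (T_gfb \<omega> A B \<gamma>) \<noteq> {}"
proof -
  obtain x where "0 \<in> {B x} + (\<Sum>i\<in>UNIV. A i x)" using assms(1) by (auto simp: zer_def)
  then obtain u where u: "\<And>i. u i \<in> A i x" and zero: "B x + (\<Sum>i\<in>UNIV. u i) = 0"
    by (auto simp: set_plus_def set_sum_alt)
  define z :: "'a ^ 'n" where "z = (\<chi> i. x - \<gamma> *\<^sub>R B x - (\<gamma> / \<omega> i) *\<^sub>R u i)"
  have "(\<Sum>i\<in>UNIV. \<omega> i *\<^sub>R (\<gamma> / \<omega> i) *\<^sub>R u i) = \<gamma> *\<^sub>R (\<Sum>i\<in>UNIV. u i)"
    using weight by (simp add: scaleR_sum_right less_imp_neq[symmetric])
  moreover have "wavg \<omega> z = wavg \<omega> (\<chi> i. x - \<gamma> *\<^sub>R B x) - (\<Sum>i\<in>UNIV. \<omega> i *\<^sub>R (\<gamma> / \<omega> i) *\<^sub>R u i)"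
    by (simp add: wavg_def z_def scaleR_diff_right sum_subtractf)
  ultimately have "wavg \<omega> z = x - \<gamma> *\<^sub>R (B x + (\<Sum>i\<in>UNIV. u i))"
    by (simp add: wavg_diagonal algebra_simps)
  then have avg: "wavg \<omega> z = x" by (simp add: zero)
  define v where "v = T2 \<omega> B \<gamma> z"
  have "v = z - (\<chi> i. \<gamma> *\<^sub>R B x)" by (simp add: v_def T2_def B_S_def avg vec_eq_iff)
  then have v: "v $ i = z $ i - \<gamma> *\<^sub>R B x" and avg_v: "wavg \<omega> v = x - \<gamma> *\<^sub>R B x" for i
    by (simp_all add: wavg_linear wavg_diagonal avg)
  have "J_A \<omega> A \<gamma> (R_S \<omega> v) $ i = x" for i
  proof -
    have "(1 / (\<gamma> / \<omega> i)) *\<^sub>R (R_S \<omega> v $ i - x) = (1 / (\<gamma> / \<omega> i)) *\<^sub>R ((\<gamma> / \<omega> i) *\<^sub>R u i)"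
      by (simp add: R_S_def P_S_def avg_v v z_def scaleR_2 algebra_simps)
    also have "\<dots> = u i" using weight[of i] \<open>0 < \<gamma>\<close> by simp
    finally show ?thesis using u[of i] weight[of i] \<open>0 < \<gamma>\<close>
      by (simp add: J_A_def resolvent_unique_solution[OF maximal])
  qed
  then have "T_gfb \<omega> A B \<gamma> z = z"
    by (simp add: T_gfb_def v_def[symmetric] T1_eq vec_eq_iff P_S_def avg_v v)
  then show ?thesis by (auto simp: fix_set_def)
qed

lemma norm_eps_err:
  assumes "0 < s"
  shows "norm (W (eps_err \<omega> A B s b a z)) \<le> norm b + (\<Sum>i\<in>UNIV. norm (a i))"
proof -
  let ?v = "T2 \<omega> B s z"
  let ?t = "T1 \<omega> A s (?v + (\<chi> i. b)) - T1 \<omega> A s ?v"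
  have "W (eps_err \<omega> A B s b a z) = W ?t + W (\<chi> i. a i)"
    by (simp add: eps_err_def T_gfb_def weight_embed_linear)
  then have "norm (W (eps_err \<omega> A B s b a z)) \<le> norm (W ?t) + norm (W (\<chi> i. a i))"
    using norm_triangle_ineq by metis
  also have "norm (W ?t) \<le> norm (W (?v + (\<chi> i. b) - ?v))"
    by (rule firmly_nonexpansive_bounds(1)[OF T1_firmly_nonexpansive[OF assms]])
  also have "\<dots> = norm b" using norm_W_diagonal by simp
  also have "norm (W (\<chi> i. a i)) \<le> (\<Sum>i\<in>UNIV. norm (a i))"
    using norm_W_le_sum[of "\<chi> i. a i"] by simp
  finally show ?thesis by simp
qed

end

section \<open>Convergence and rate of the non-stationary iteration\<close>

theorem theorem5:
  fixes B :: "'a::{real_inner, complete_space} \<Rightarrow> 'a"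
    and A :: "'n::finite \<Rightarrow> 'a \<Rightarrow> 'a set"
    and \<omega> :: "'n \<Rightarrow> real"
    and \<beta> \<gamma> \<gamma>lo \<gamma>hi :: real
    and \<gamma>s lam :: "nat \<Rightarrow> real"
    and b :: "nat \<Rightarrow> 'a"
    and a :: "'n \<Rightarrow> nat \<Rightarrow> 'a"
    and z :: "nat \<Rightarrow> 'a ^ 'n"
  assumes "cocoercive \<beta> B"
    and "\<And>i. maximal_monotone (A i)"
    and "\<And>i. 0 < \<omega> i \<and> \<omega> i < 1" and "(\<Sum>i\<in>UNIV. \<omega> i) = 1"
    and iteration: "\<And>k. z (Suc k) = z k + lam k *\<^sub>R
          (T_gfb \<omega> A B \<gamma> (z k) + pi_err \<omega> A B \<gamma> (\<gamma>s k) (b k) (\<lambda>i. a i k) (z k) - z k)"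
    and A1: "zer (\<lambda>x. {B x} + (\<Sum>i\<in>UNIV. A i x)) \<noteq> {}"
    and A2: "\<And>k. 0 < lam k \<and> lam k < 1 / avg_const \<beta> (\<gamma>s k)"
            "(INF k. lam k * (1 / avg_const \<beta> (\<gamma>s k) - lam k)) > 0"
    and A3: "summable (\<lambda>k. lam k * norm (b k))"
            "\<And>i. summable (\<lambda>k. lam k * norm (a i k))"
    and A4: "0 < \<gamma>lo" "\<And>k. \<gamma>lo \<le> \<gamma>s k \<and> \<gamma>s k \<le> \<gamma>hi" "\<gamma>hi < 2 * \<beta>"
            "\<gamma> \<in> {\<gamma>lo..\<gamma>hi}" "summable (\<lambda>k. lam k * \<bar>\<gamma>s k - \<gamma>\<bar>)"
  shows "(\<exists>l \<in> fix_set (T_gfb \<omega> A B \<gamma>). weakly_converges \<omega> z l) \<and>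
    (summable (\<lambda>k. real (k + 1) * \<bar>\<gamma>s k - \<gamma>\<bar>) \<and>
     summable (\<lambda>k. real (k + 1) * norm (b k)) \<and>
     (\<forall>i. summable (\<lambda>k. real (k + 1) * norm (a i k))) \<longrightarrow>
     (\<exists>C1::real. \<forall>k.
        wnorm \<omega> (z k - T_gfb \<omega> A B \<gamma> (z k)) \<le>
          sqrt (((INF w \<in> fix_set (T_gfb \<omega> A B \<gamma>). wnorm \<omega> (z 0 - w))\<^sup>2 + C1) /
            ((INF j. lam j * (1 / avg_const \<beta> (\<gamma>s j) - lam j)) * real (k + 1)))))"
proof -
  interpret generalized_forward_backward B A \<omega> \<beta>
    using assms(1-4) by unfold_locales auto
  let ?\<tau> = "INF k. lam k * (1 / avg_const \<beta> (\<gamma>s k) - lam k)"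
  let ?e = "\<lambda>k. norm (W (z k - T_gfb \<omega> A B \<gamma> (z k)))"
  have \<gamma>: "0 < \<gamma>" "\<gamma> < 2 * \<beta>" and \<gamma>s: "0 < \<gamma>s k" "\<gamma>s k < 2 * \<beta>" for k
    using A4(1,3,4) A4(2)[of k] by auto
  have lam_le: "lam k \<le> 2" and inv_avg: "1 / avg_const \<beta> (\<gamma>s k) \<le> 2" for k
  proof -
    show "1 / avg_const \<beta> (\<gamma>s k) \<le> 2"
      using beta \<gamma>s(1)[of k] by (simp add: avg_const_def divide_simps)
    then show "lam k \<le> 2" using A2(1)[of k] by linarith
  qed
  have \<tau>: "?\<tau> \<le> lam k * (1 / avg_const \<beta> (\<gamma>s k) - lam k)" for k
    using A2(1) by (intro cINF_lower bdd_belowI[of _ 0]) (auto intro!: mult_nonneg_nonneg less_imp_le)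
  \<comment> \<open>The margin bounds the relaxation parameters away from zero, so the factor \<open>lam k\<close> may be
    dropped from all summability assumptions.\<close>
  have lam_ge: "?\<tau> / 2 \<le> lam k" for k
  proof -
    have "lam k * (1 / avg_const \<beta> (\<gamma>s k) - lam k) \<le> lam k * 2"
      using A2(1)[of k] inv_avg[of k] by (intro mult_left_mono) auto
    then show ?thesis using \<tau>[of k] by linarith
  qed
  have unweighted: "summable f" if "summable (\<lambda>k. lam k * f k)" and f: "\<And>k. 0 \<le> f k" for f
  proof (rule summable_comparison_test')
    show "summable (\<lambda>k. 2 / ?\<tau> * (lam k * f k))" using that(1) by (rule summable_mult)
    show "norm (f k) \<le> 2 / ?\<tau> * (lam k * f k)" if "0 \<le> k" for k
    proof -
      have "?\<tau> / 2 * f k \<le> lam k * f k" using lam_ge f by (rule mult_right_mono)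
      then show ?thesis using A2(2) f[of k] by (simp add: field_simps)
    qed
  qed
  obtain K where K: "0 \<le> K" and step_size: "\<And>s z. 0 < s \<Longrightarrow> s < 2 * \<beta> \<Longrightarrow>
      norm (W (T_gfb \<omega> A B s z - T_gfb \<omega> A B \<gamma> z)) \<le> \<bar>s - \<gamma>\<bar> * K * (1 + norm (W z))"
    using T_gfb_step_size[OF \<gamma>] by blast
  define \<epsilon> where "\<epsilon> k = eps_err \<omega> A B (\<gamma>s k) (b k) (\<lambda>i. a i k) (z k)" for k
  have \<epsilon>: "norm (W (\<epsilon> k)) \<le> norm (b k) + (\<Sum>i\<in>UNIV. norm (a i k))" for k
    unfolding \<epsilon>_def by (rule norm_eps_err[OF \<gamma>s(1)])
  have \<epsilon>_summable: "summable (\<lambda>k. c k * norm (W (\<epsilon> k)))"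
    if c: "\<And>k. 0 \<le> c k" and "summable (\<lambda>k. c k * norm (b k))" "\<And>i. summable (\<lambda>k. c k * norm (a i k))"
    for c :: "nat \<Rightarrow> real"
  proof (rule summable_comparison_test')
    show "summable (\<lambda>k. c k * norm (b k) + (\<Sum>i\<in>UNIV. c k * norm (a i k)))"
      using that(2,3) by (intro summable_add summable_sum)
    show "norm (c k * norm (W (\<epsilon> k))) \<le> c k * norm (b k) + (\<Sum>i\<in>UNIV. c k * norm (a i k))"
      if "0 \<le> k" for k
    proof -
      have "c k * norm (W (\<epsilon> k)) \<le> c k * (norm (b k) + (\<Sum>i\<in>UNIV. norm (a i k)))"
        using \<epsilon> c by (rule mult_left_mono)
      then show ?thesis using c[of k] by (simp add: distrib_left sum_distrib_left)
    qed
  qed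
  \<comment> \<open>Conjugation by the isometry \<open>W\<close> turns the weighted geometry into that of an inner product
    space, where the abstract iteration lives.\<close>
  define T where "T s h = W (T_gfb \<omega> A B s (W_inv h))" for s h
  have T_diff: "T s x - T s' y = W (T_gfb \<omega> A B s (W_inv x) - T_gfb \<omega> A B s' (W_inv y))" for s s' x y
    by (simp add: T_def weight_embed_linear)
  have W_diff: "x - y = W (W_inv x - W_inv y)" for x y
    by (simp add: weight_embed_linear)
  have fix_T: "T \<gamma> h = h \<longleftrightarrow> W_inv h \<in> fix_set (T_gfb \<omega> A B \<gamma>)" for h
  proof -
    have "T \<gamma> h = h \<longleftrightarrow> W_inv (T \<gamma> h) = W_inv h" by (metis W_inv(2))
    then show ?thesis by (simp add: T_def fix_set_def)
  qed
  interpret perturbed_averaged_iteration "T \<gamma>" "\<lambda>k. T (\<gamma>s k)" lam "\<lambda>k. K * \<bar>\<gamma>s k - \<gamma>\<bar>" ?\<tau>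
    "\<lambda>k. W (\<epsilon> k)" "\<lambda>k. W (z k)"
  proof
    fix x y :: "'a ^ 'n" and k
    show "norm (T \<gamma> x - T \<gamma> y) \<le> norm (x - y)"
      unfolding T_diff W_diff[of x y] by (rule T_gfb_nonexpansive[OF \<gamma>])
    show "norm (T (\<gamma>s k) x - T (\<gamma>s k) y) \<le> norm (x - y)"
      unfolding T_diff W_diff[of x y] by (rule T_gfb_nonexpansive[OF \<gamma>s])
    have rearrange: "x - T (\<gamma>s k) x - (y - T (\<gamma>s k) y) = x - y - (T (\<gamma>s k) x - T (\<gamma>s k) y)"
      by simp
    show "(norm (x - y - lam k *\<^sub>R (x - T (\<gamma>s k) x - (y - T (\<gamma>s k) y))))\<^sup>2
        \<le> (norm (x - y))\<^sup>2 - ?\<tau> * (norm (x - T (\<gamma>s k) x - (y - T (\<gamma>s k) y)))\<^sup>2"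
      unfolding rearrange T_diff W_diff[of x y]
      using A2(1)[of k] by (intro T_gfb_relaxed[OF \<gamma>s(1) _ \<tau> refl]) simp
    show "norm (T (\<gamma>s k) x - T \<gamma> x) \<le> K * \<bar>\<gamma>s k - \<gamma>\<bar> * (1 + norm x)"
      using step_size[OF \<gamma>s, of k "W_inv x"] by (simp add: T_diff mult.commute[of K])
    show "W (z (Suc k)) = W (z k) + lam k *\<^sub>R (T (\<gamma>s k) (W (z k)) + W (\<epsilon> k) - W (z k))"
      unfolding iteration pi_err_def \<epsilon>_def T_def weight_embed_linear W_inv by simp
    show "summable (\<lambda>k. K * \<bar>\<gamma>s k - \<gamma>\<bar>)"
      by (rule summable_mult[OF unweighted[OF A4(5)]]) simp
    show "summable (\<lambda>k. norm (W (\<epsilon> k)))"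
      using A2(1) A3 by (intro unweighted[OF \<epsilon>_summable]) (auto intro: less_imp_le)
    obtain w where "w \<in> fix_set (T_gfb \<omega> A B \<gamma>)"
      using fix_set_T_gfb_nonempty[OF A1 \<gamma>(1)] by blast
    then show "fix_set (T \<gamma>) \<noteq> {}" using fix_T[of "W w"] by (auto simp: fix_set_def)
  qed (use A2 lam_le K in auto)
  have residual: "norm (W (z k) - T \<gamma> (W (z k))) = ?e k" for k
    by (simp add: T_def weight_embed_linear)
  show ?thesis
  proof (intro conjI impI)
    obtain l where l: "l \<in> fix_set (T \<gamma>)" "\<And>u. (\<lambda>k. inner (W (z k)) u) \<longlonglongrightarrow> inner l u"
      using weakly_convergent by blast
    have "W_inv l \<in> fix_set (T_gfb \<omega> A B \<gamma>)" using l(1) fix_T by (simp add: fix_set_def)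
    moreover have "weakly_converges \<omega> z (W_inv l)"
      using l(2) by (simp add: weakly_converges_def winner_W)
    ultimately show "\<exists>l\<in>fix_set (T_gfb \<omega> A B \<gamma>). weakly_converges \<omega> z l" by blast
  next
    assume weighted: "summable (\<lambda>k. real (k + 1) * \<bar>\<gamma>s k - \<gamma>\<bar>) \<and>
      summable (\<lambda>k. real (k + 1) * norm (b k)) \<and> (\<forall>i. summable (\<lambda>k. real (k + 1) * norm (a i k)))"
    have "summable (\<lambda>k. real (k + 1) * (K * \<bar>\<gamma>s k - \<gamma>\<bar>))"
      using summable_mult[of "\<lambda>k. real (k + 1) * \<bar>\<gamma>s k - \<gamma>\<bar>" K] weighted
      by (simp only: mult.left_commute)
    moreover have "summable (\<lambda>k. real (k + 1) * norm (W (\<epsilon> k)))"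
      using weighted by (intro \<epsilon>_summable) auto
    ultimately obtain C where C: "\<And>k. real (k + 1) * (?e k)\<^sup>2 \<le> C"
      using residual_rate unfolding residual by blast
    \<comment> \<open>The residuals satisfy \<open>(?e k)\<^sup>2 \<le> C / (k + 1)\<close>; this is the bound with
      \<open>C1 = ?\<tau> * C\<close>, as the squared distance only adds a nonnegative amount.\<close>
    have "wnorm \<omega> (z k - T_gfb \<omega> A B \<gamma> (z k)) \<le>
        sqrt (((INF w \<in> fix_set (T_gfb \<omega> A B \<gamma>). wnorm \<omega> (z 0 - w))\<^sup>2 + ?\<tau> * C) / (?\<tau> * real (k + 1)))"
      (is "_ \<le> sqrt ((?d\<^sup>2 + _) / _)") for k
    proof -
      have "?\<tau> * (real (k + 1) * (?e k)\<^sup>2) \<le> ?\<tau> * C"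
        using C[of k] A2(2) by (intro mult_left_mono) auto
      then have "(?e k)\<^sup>2 * (?\<tau> * real (k + 1)) \<le> ?d\<^sup>2 + ?\<tau> * C"
        by (simp add: mult_ac add_increasing)
      moreover have "0 < ?\<tau> * real (k + 1)" using A2(2) by simp
      ultimately have "(?e k)\<^sup>2 \<le> (?d\<^sup>2 + ?\<tau> * C) / (?\<tau> * real (k + 1))"
        by (simp only: pos_le_divide_eq)
      then show ?thesis unfolding wnorm_W by (rule real_le_rsqrt)
    qed
    then show "\<exists>C1. \<forall>k. wnorm \<omega> (z k - T_gfb \<omega> A B \<gamma> (z k)) \<le>
        sqrt (((INF w \<in> fix_set (T_gfb \<omega> A B \<gamma>). wnorm \<omega> (z 0 - w))\<^sup>2 + C1) / (?\<tau> * real (k + 1)))"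
      by blast
  qed
qed

end
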